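(* Let $B$ be a Q-Koszul algebra with weight poset $\Gamma$. Let $M$ be a non-negatively graded Q-linear $B$-module. Assume for each $i\geq0$ that $M_{i}$ (regarded as a $B_{0}\cong B/B_{\geq 1}$-module) has a $\Delta^{0}$-filtration. Then, for each $i\ge 0$, $$M_{\geq i}\langle-i\rangle:=\Big(\bigoplus_{j\geq i}M_{j}\Big)\langle -i\rangle$$ is a Q-linear $B$-module.
   Context: Algebras and modules are finite dimensional over an algebraically closed field $k$ (of arbitrary characteristic). For graded modules $M,N$ over a graded algebra $B$, $\operatorname{ext}^n_B(M,N)$ denotes the Ext-groups in the category of graded $B$-modules, and $N\langle r\rangle$ is the shifted module $N\langle r\rangle_i:=N_{i-r}$. A positively graded algebra $B=\bigoplus_{n\ge0}B_n$ is Q-Koszul (with weight poset $\Gamma$) if: (1) $B_0$ is quasi-hereditary with weight poset $\Gamma$, with standard and costandard modules denoted $\Delta^0(\gamma)$ and $\nabla_0(\gamma)$, $\gamma\in\Gamma$; and (2) when $\Delta^0(\gamma),\nabla_0(\gamma)$ are regarded as graded $B$-modules of pure grade $0$ (via $B\to B/B_{\ge1}\cong B_0$), then for all $n\in\mathbb N$, $r\in\mathbb Z$, $\lambda,\mu\in\Gamma$, $\operatorname{ext}^n_B(\Delta^0(\lambda),\nabla_0(\mu)\langle r\rangle)\neq0$ implies $n=r$. A non-negatively graded $B$-module $M$ is Q-linear if for all $n\in\mathbb N$, $r\in\mathbb Z$, $\gamma\in\Gamma$, $\operatorname{ext}^n_B(M,\nabla_0(\gamma)\langle r\rangle)\neq0$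 implies $n=r$. A $\Delta^0$-filtration of a $B_0$-module is a finite filtration whose sections are isomorphic to modules $\Delta^0(\gamma)$, $\gamma\in\Gamma$. *)

theory Defs
  imports "HOL-Computational_Algebra.Polynomial" "HOL-Library.Function_Algebras"
begin

section \<open>Finite-dimensional algebras and modules\<close>

text \<open>
  An algebra is a linear subspace of an ambient (not necessarily unital) associative algebra;
  it carries its own unit element. This lets an algebra and its degree-0 part share their
  operations.
\<close>

record ('k, 'b) kalg =
  acarrier :: "'b set"
  aone :: 'b
  ascale :: "'k \<Rightarrow> 'b \<Rightarrow> 'b"

definition fd_algebra :: "('k::field, 'b::ring, 'z) kalg_scheme \<Rightarrow> bool" where
  "fd_algebra A \<longleftrightarrow>
     vector_space (ascale A) \<and>
     (\<forall>c a b. ascale A c (a * b) = ascale A c a * b \<and> ascale A c (a * b) = a * ascale A c b) \<and>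
     module.subspace (ascale A) (acarrier A) \<and>
     (\<exists>S. finite S \<and> acarrier A = module.span (ascale A) S) \<and>
     (\<forall>a\<in>acarrier A. \<forall>b\<in>acarrier A. a * b \<in> acarrier A) \<and>
     aone A \<in> acarrier A \<and>
     (\<forall>a\<in>acarrier A. aone A * a = a \<and> a * aone A = a)"

text \<open>
  Modules are left modules. The scalars act on a module over an algebra with unit \<open>e\<close>
  through \<open>c \<mapsto> c e\<close>; homomorphisms are then automatically linear over the ground field.
\<close>

record ('b, 'v) amod =
  mcarrier :: "'v set"
  act :: "'b \<Rightarrow> 'v \<Rightarrow> 'v"

definition add_subgroup :: "'v::ab_group_add set \<Rightarrow> bool" where
  "add_subgroup U \<longleftrightarrow> 0 \<in> U \<and> (\<forall>x\<in>U. \<forall>y\<in>U. x - y \<in> U)"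

definition fd_module ::
  "('k::field, 'b::ring, 'z) kalg_scheme \<Rightarrow> ('b, 'v::ab_group_add, 'y) amod_scheme \<Rightarrow> bool" where
  "fd_module A M \<longleftrightarrow>
     add_subgroup (mcarrier M) \<and>
     (\<forall>a\<in>acarrier A. \<forall>x\<in>mcarrier M. act M a x \<in> mcarrier M) \<and>
     (\<forall>a\<in>acarrier A. \<forall>x\<in>mcarrier M. \<forall>y\<in>mcarrier M. act M a (x + y) = act M a x + act M a y) \<and>
     (\<forall>a\<in>acarrier A. \<forall>b\<in>acarrier A. \<forall>x\<in>mcarrier M.
        act M (a + b) x = act M a x + act M b x \<and> act M (a * b) x = act M a (act M b x)) \<and>
     (\<forall>x\<in>mcarrier M. act M (aone A) x = x) \<and>
     (\<exists>S. finite S \<and> S \<subseteq> mcarrier M \<and>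
        (\<forall>x\<in>mcarrier M. \<exists>c. x = (\<Sum>s\<in>S. act M (ascale A (c s) (aone A)) s)))"

definition submodule ::
  "('k, 'b, 'z) kalg_scheme \<Rightarrow> ('b, 'v::ab_group_add, 'y) amod_scheme \<Rightarrow> 'v set \<Rightarrow> bool" where
  "submodule A M U \<longleftrightarrow>
     U \<subseteq> mcarrier M \<and> add_subgroup U \<and> (\<forall>a\<in>acarrier A. \<forall>x\<in>U. act M a x \<in> U)"

definition mod_hom ::
  "('k, 'b, 'z) kalg_scheme \<Rightarrow> ('b, 'v::ab_group_add, 'y) amod_scheme \<Rightarrow>
   ('b, 'w::ab_group_add, 'x) amod_scheme \<Rightarrow> ('v \<Rightarrow> 'w) \<Rightarrow> bool" where
  "mod_hom A M N f \<longleftrightarrow>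
     (\<forall>x\<in>mcarrier M. f x \<in> mcarrier N) \<and>
     (\<forall>x\<in>mcarrier M. \<forall>y\<in>mcarrier M. f (x + y) = f x + f y) \<and>
     (\<forall>a\<in>acarrier A. \<forall>x\<in>mcarrier M. f (act M a x) = act N a (f x))"

definition mod_iso ::
  "('k, 'b, 'z) kalg_scheme \<Rightarrow> ('b, 'v::ab_group_add, 'y) amod_scheme \<Rightarrow>
   ('b, 'w::ab_group_add, 'x) amod_scheme \<Rightarrow> bool" where
  "mod_iso A M N \<longleftrightarrow> (\<exists>f. mod_hom A M N f \<and> bij_betw f (mcarrier M) (mcarrier N))"

definition hom_kernel ::
  "('b, 'v::ab_group_add, 'y) amod_scheme \<Rightarrow> ('v \<Rightarrow> 'w::ab_group_add) \<Rightarrow> 'v set" where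
  "hom_kernel M f = {x \<in> mcarrier M. f x = 0}"

text \<open>
  \<open>V / U \<cong> X\<close> for submodules \<open>U \<subseteq> V\<close> of \<open>M\<close>, written as a short exact sequence
  \<open>0 \<rightarrow> U \<rightarrow> V \<rightarrow> X \<rightarrow> 0\<close>.
\<close>

definition quotient_iso ::
  "('k, 'b, 'z) kalg_scheme \<Rightarrow> ('b, 'v::ab_group_add, 'y) amod_scheme \<Rightarrow> 'v set \<Rightarrow> 'v set \<Rightarrow>
   ('b, 'w::ab_group_add, 'x) amod_scheme \<Rightarrow> bool" where
  "quotient_iso A M V U X \<longleftrightarrow>
     submodule A M U \<and> submodule A M V \<and> U \<subseteq> V \<and>
     (\<exists>f. mod_hom A (M\<lparr>mcarrier := V\<rparr>) X f \<and> f ` V = mcarrier X \<and>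
          hom_kernel (M\<lparr>mcarrier := V\<rparr>) f = U)"

text \<open>
  A finite chain of submodules from \<open>U\<close> up to \<open>V\<close> in \<open>M\<close>, each of whose sections is
  isomorphic to a member of \<open>\<X>\<close>; equivalently, a filtration of \<open>V / U\<close> with such sections.
\<close>

definition filtration_between ::
  "('k, 'b, 'z) kalg_scheme \<Rightarrow> ('b, 'w::ab_group_add, 'x) amod_scheme set \<Rightarrow>
   ('b, 'v::ab_group_add, 'y) amod_scheme \<Rightarrow> 'v set \<Rightarrow> 'v set \<Rightarrow> bool" where
  "filtration_between A \<X> M U V \<longleftrightarrow>
     submodule A M U \<and> submodule A M V \<and>
     (\<exists>n F. F 0 = U \<and> F n = V \<and>
        (\<forall>i<n. \<exists>X\<in>\<X>. quotient_iso A M (F (Suc i)) (F i) X))"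

definition has_filtration ::
  "('k, 'b, 'z) kalg_scheme \<Rightarrow> ('b, 'w::ab_group_add, 'x) amod_scheme set \<Rightarrow>
   ('b, 'v::ab_group_add, 'y) amod_scheme \<Rightarrow> bool" where
  "has_filtration A \<X> M \<longleftrightarrow> filtration_between A \<X> M {0} (mcarrier M)"

definition simple_module ::
  "('k::field, 'b::ring, 'z) kalg_scheme \<Rightarrow> ('b, 'v::ab_group_add, 'y) amod_scheme \<Rightarrow> bool" where
  "simple_module A M \<longleftrightarrow>
     fd_module A M \<and> mcarrier M \<noteq> {0} \<and>
     (\<forall>U. submodule A M U \<longrightarrow> U = {0} \<or> U = mcarrier M)"

definition maximal_submodule ::
  "('k, 'b, 'z) kalg_scheme \<Rightarrow> ('b, 'v::ab_group_add, 'y) amod_scheme \<Rightarrow> 'v set \<Rightarrow> bool" where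
  "maximal_submodule A M U \<longleftrightarrow>
     submodule A M U \<and> U \<noteq> mcarrier M \<and>
     (\<forall>W. submodule A M W \<and> U \<subseteq> W \<longrightarrow> W = U \<or> W = mcarrier M)"

definition radical ::
  "('k, 'b, 'z) kalg_scheme \<Rightarrow> ('b, 'v::ab_group_add, 'y) amod_scheme \<Rightarrow> 'v set" where
  "radical A M = mcarrier M \<inter> \<Inter>{U. maximal_submodule A M U}"

definition socle ::
  "('k::field, 'b::ring, 'z) kalg_scheme \<Rightarrow> ('b, 'v::ab_group_add, 'y) amod_scheme \<Rightarrow> 'v set" where
  "socle A M = \<Inter>{W. submodule A M W \<and>
     (\<forall>S. submodule A M S \<and> simple_module A (M\<lparr>mcarrier := S\<rparr>) \<longrightarrow> S \<subseteq> W)}"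

text \<open>
  HOL cannot quantify over types inside a formula. Statements about all finite-dimensional
  modules therefore quantify over the modules carried by subsets of \<open>k\<^sup>\<nat>\<close>; every
  finite-dimensional module over a \<open>k\<close>-algebra is isomorphic to one of these (choose a basis).
\<close>

type_synonym 'k coords = "nat \<Rightarrow> 'k"

definition projective_module ::
  "('k::field, 'b::ring, 'z) kalg_scheme \<Rightarrow> ('b, 'k coords) amod \<Rightarrow> bool" where
  "projective_module A P \<longleftrightarrow> fd_module A P \<and>
     (\<forall>(X :: ('b, 'k coords) amod) (Y :: ('b, 'k coords) amod) p f.
        fd_module A X \<and> fd_module A Y \<and> mod_hom A X Y p \<and> p ` mcarrier X = mcarrier Y \<and>
        mod_hom A P Y f \<longrightarrow>
        (\<exists>g. mod_hom A P X g \<and> (\<forall>x\<in>mcarrier P. p (g x) = f x)))"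

definition injective_module ::
  "('k::field, 'b::ring, 'z) kalg_scheme \<Rightarrow> ('b, 'k coords) amod \<Rightarrow> bool" where
  "injective_module A Q \<longleftrightarrow> fd_module A Q \<and>
     (\<forall>(X :: ('b, 'k coords) amod) (Y :: ('b, 'k coords) amod) j f.
        fd_module A X \<and> fd_module A Y \<and> mod_hom A X Y j \<and> inj_on j (mcarrier X) \<and>
        mod_hom A X Q f \<longrightarrow>
        (\<exists>g. mod_hom A Y Q g \<and> (\<forall>x\<in>mcarrier X. g (j x) = f x)))"

text \<open>Projective cover: surjection from a projective with superfluous kernel.\<close>

definition projective_cover ::
  "('k::field, 'b::ring, 'z) kalg_scheme \<Rightarrow> ('b, 'k coords) amod \<Rightarrow>
   ('b, 'v::ab_group_add) amod \<Rightarrow> bool" where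
  "projective_cover A P M \<longleftrightarrow> projective_module A P \<and>
     (\<exists>p. mod_hom A P M p \<and> p ` mcarrier P = mcarrier M \<and>
        (\<forall>U. submodule A P U \<and>
             (\<forall>x\<in>mcarrier P. \<exists>u\<in>U. \<exists>y\<in>hom_kernel P p. x = u + y) \<longrightarrow> U = mcarrier P))"

text \<open>Injective hull: embedding into an injective with essential image.\<close>

definition injective_hull ::
  "('k::field, 'b::ring, 'z) kalg_scheme \<Rightarrow> ('b, 'k coords) amod \<Rightarrow>
   ('b, 'v::ab_group_add) amod \<Rightarrow> bool" where
  "injective_hull A Q M \<longleftrightarrow> injective_module A Q \<and>
     (\<exists>j. mod_hom A M Q j \<and> inj_on j (mcarrier M) \<and>
        (\<forall>U. submodule A Q U \<and> U \<inter> j ` mcarrier M = {0} \<longrightarrow> U = {0}))"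


section \<open>Quasi-hereditary algebras\<close>

text \<open>
  The module category of \<open>A\<close> is a highest weight category (Cline--Parshall--Scott) with finite
  weight poset \<open>\<Gamma>\<close>, ordered by the class order of \<open>'w\<close>. The modules \<open>L \<gamma>\<close> represent
  the isomorphism classes of simple modules, each exactly once.
  The axioms for \<open>\<Delta>\<close> determine each \<open>\<Delta> \<gamma>\<close> up to isomorphism, as the largest quotient
  of the projective cover of \<open>L \<gamma>\<close> whose composition factors are \<open>L \<mu>\<close> with
  \<open>\<mu> \<le> \<gamma>\<close>; dually, those for \<open>nabla\<close> determine the costandard modules. Each half
  implies that modules satisfying the other half exist (the opposite of a quasi-hereditary
  algebra is quasi-hereditary for the same poset), so requiring both only fixes notation
  for the standard and costandard modules.
\<close>

definition quasi_hereditary ::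
  "('k::field, 'b::ring, 'z) kalg_scheme \<Rightarrow> 'w::order set \<Rightarrow>
   ('w \<Rightarrow> ('b, 'd::ab_group_add) amod) \<Rightarrow> ('w \<Rightarrow> ('b, 'e::ab_group_add) amod) \<Rightarrow> bool" where
  "quasi_hereditary A \<Gamma> \<Delta> nabla \<longleftrightarrow>
     fd_algebra A \<and> finite \<Gamma> \<and>
     (\<forall>\<gamma>\<in>\<Gamma>. fd_module A (\<Delta> \<gamma>) \<and> fd_module A (nabla \<gamma>)) \<and>
     (\<exists>L :: 'w \<Rightarrow> ('b, 'k coords) amod.
        (\<forall>\<gamma>\<in>\<Gamma>. simple_module A (L \<gamma>)) \<and>
        (\<forall>S :: ('b, 'k coords) amod. simple_module A S \<longrightarrow> (\<exists>!\<gamma>. \<gamma> \<in> \<Gamma> \<and> mod_iso A S (L \<gamma>))) \<and>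
        (\<forall>\<gamma>\<in>\<Gamma>.
           quotient_iso A (\<Delta> \<gamma>) (mcarrier (\<Delta> \<gamma>)) (radical A (\<Delta> \<gamma>)) (L \<gamma>) \<and>
           filtration_between A (L ` {\<mu>\<in>\<Gamma>. \<mu> < \<gamma>}) (\<Delta> \<gamma>) {0} (radical A (\<Delta> \<gamma>)) \<and>
           (\<exists>P p. projective_cover A P (L \<gamma>) \<and>
              mod_hom A P (\<Delta> \<gamma>) p \<and> p ` mcarrier P = mcarrier (\<Delta> \<gamma>) \<and>
              filtration_between A (\<Delta> ` {\<nu>\<in>\<Gamma>. \<gamma> < \<nu>}) P {0} (hom_kernel P p))) \<and>
        (\<forall>\<gamma>\<in>\<Gamma>.
           mod_iso A ((nabla \<gamma>)\<lparr>mcarrier := socle A (nabla \<gamma>)\<rparr>) (L \<gamma>) \<and>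
           filtration_between A (L ` {\<mu>\<in>\<Gamma>. \<mu> < \<gamma>}) (nabla \<gamma>)
             (socle A (nabla \<gamma>)) (mcarrier (nabla \<gamma>)) \<and>
           (\<exists>Q j. injective_hull A Q (L \<gamma>) \<and>
              mod_hom A (nabla \<gamma>) Q j \<and> inj_on j (mcarrier (nabla \<gamma>)) \<and>
              filtration_between A (nabla ` {\<nu>\<in>\<Gamma>. \<gamma> < \<nu>}) Q (j ` mcarrier (nabla \<gamma>)) (mcarrier Q))))"


section \<open>Graded algebras and graded modules\<close>

definition graded_decomp :: "('i \<Rightarrow> 'v::ab_group_add set) \<Rightarrow> 'v \<Rightarrow> ('i \<Rightarrow> 'v) \<Rightarrow> bool" where
  "graded_decomp C x f \<longleftrightarrow>
     (\<forall>i. f i \<in> C i) \<and> finite {i. f i \<noteq> 0} \<and> x = (\<Sum>i | f i \<noteq> 0. f i)"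

definition direct_sum_of :: "'v::ab_group_add set \<Rightarrow> ('i \<Rightarrow> 'v set) \<Rightarrow> bool" where
  "direct_sum_of V C \<longleftrightarrow>
     (\<forall>i. add_subgroup (C i) \<and> C i \<subseteq> V) \<and> (\<forall>x\<in>V. \<exists>!f. graded_decomp C x f)"

record ('k, 'b) gkalg = "('k, 'b) kalg" +
  agr :: "nat \<Rightarrow> 'b set"

definition graded_algebra :: "('k::field, 'b::ring) gkalg \<Rightarrow> bool" where
  "graded_algebra B \<longleftrightarrow>
     fd_algebra B \<and>
     (\<forall>n. module.subspace (ascale B) (agr B n)) \<and>
     direct_sum_of (acarrier B) (agr B) \<and>
     aone B \<in> agr B 0 \<and>
     (\<forall>m n. \<forall>a\<in>agr B m. \<forall>b\<in>agr B n. a * b \<in> agr B (m + n))"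

definition degree_zero_algebra :: "('k, 'b) gkalg \<Rightarrow> ('k, 'b) kalg" where
  "degree_zero_algebra B = \<lparr>acarrier = agr B 0, aone = aone B, ascale = ascale B\<rparr>"

text \<open>The projection \<open>B \<rightarrow> B / B\<^bsub>\<ge>1\<^esub> \<cong> B\<^sub>0\<close>.\<close>

definition degree_zero_part :: "('k, 'b::ring) gkalg \<Rightarrow> 'b \<Rightarrow> 'b" where
  "degree_zero_part B b = (THE f. graded_decomp (agr B) b f) 0"

record ('b, 'v) gmod = "('b, 'v) amod" +
  gcomp :: "int \<Rightarrow> 'v set"

definition graded_module ::
  "('k::field, 'b::ring) gkalg \<Rightarrow> ('b, 'v::ab_group_add) gmod \<Rightarrow> bool" where
  "graded_module B M \<longleftrightarrow>
     fd_module B M \<and>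
     direct_sum_of (mcarrier M) (gcomp M) \<and>
     (\<forall>n i. \<forall>b\<in>agr B n. \<forall>x\<in>gcomp M i. act M b x \<in> gcomp M (int n + i))"

definition nonneg_graded :: "('b, 'v::ab_group_add) gmod \<Rightarrow> bool" where
  "nonneg_graded M \<longleftrightarrow> (\<forall>i<0. gcomp M i = {0})"

definition graded_hom ::
  "('k, 'b) gkalg \<Rightarrow> ('b, 'v::ab_group_add) gmod \<Rightarrow> ('b, 'w::ab_group_add) gmod \<Rightarrow>
   ('v \<Rightarrow> 'w) \<Rightarrow> bool" where
  "graded_hom B M N f \<longleftrightarrow> mod_hom B M N f \<and> (\<forall>i. f ` gcomp M i \<subseteq> gcomp N i)"

text \<open>The shift \<open>M\<langle>r\<rangle>\<close>.\<close>

definition shift :: "int \<Rightarrow> ('b, 'v) gmod \<Rightarrow> ('b, 'v) gmod" where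
  "shift r M = M\<lparr>gcomp := (\<lambda>i. gcomp M (i - r))\<rparr>"

text \<open>The submodule \<open>M\<^bsub>\<ge>i\<^esub>\<close>.\<close>

definition truncation :: "int \<Rightarrow> ('b, 'v::ab_group_add) gmod \<Rightarrow> ('b, 'v) gmod" where
  "truncation i M =
     \<lparr>mcarrier = {x \<in> mcarrier M. \<exists>f. graded_decomp (gcomp M) x f \<and> (\<forall>j<i. f j = 0)},
      act = act M,
      gcomp = (\<lambda>j. if i \<le> j then gcomp M j else {0})\<rparr>"

text \<open>The component \<open>M\<^sub>i\<close>, to be regarded as a \<open>B\<^sub>0\<close>-module.\<close>

definition component :: "('b, 'v) gmod \<Rightarrow> int \<Rightarrow> ('b, 'v) amod" where
  "component M i = \<lparr>mcarrier = gcomp M i, act = act M\<rparr>"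

text \<open>A \<open>B\<^sub>0\<close>-module as a graded \<open>B\<close>-module of pure grade \<open>0\<close>.\<close>

definition inflate ::
  "('k, 'b::ring) gkalg \<Rightarrow> ('b, 'v::ab_group_add) amod \<Rightarrow> ('b, 'v) gmod" where
  "inflate B X =
     \<lparr>mcarrier = mcarrier X,
      act = (\<lambda>b. act X (degree_zero_part B b)),
      gcomp = (\<lambda>i. if i = 0 then mcarrier X else {0})\<rparr>"


section \<open>Graded Ext\<close>

definition graded_injective ::
  "('k::field, 'b::ring) gkalg \<Rightarrow> ('b, 'k coords) gmod \<Rightarrow> bool" where
  "graded_injective B I \<longleftrightarrow> graded_module B I \<and>
     (\<forall>(X :: ('b, 'k coords) gmod) (Y :: ('b, 'k coords) gmod) j f.
        graded_module B X \<and> graded_module B Y \<and> graded_hom B X Y j \<and> inj_on j (mcarrier X) \<and>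
        graded_hom B X I f \<longrightarrow>
        (\<exists>g. graded_hom B Y I g \<and> (\<forall>x\<in>mcarrier X. g (j x) = f x)))"

text \<open>\<open>0 \<rightarrow> N \<rightarrow> I\<^sub>0 \<rightarrow> I\<^sub>1 \<rightarrow> \<dots>\<close>, with coaugmentation \<open>\<epsilon>\<close> and differentials \<open>d n\<close>.\<close>

definition injective_resolution ::
  "('k::field, 'b::ring) gkalg \<Rightarrow> ('b, 'v::ab_group_add) gmod \<Rightarrow> ('v \<Rightarrow> 'k coords) \<Rightarrow>
   (nat \<Rightarrow> ('b, 'k coords) gmod) \<Rightarrow> (nat \<Rightarrow> 'k coords \<Rightarrow> 'k coords) \<Rightarrow> bool" where
  "injective_resolution B N \<epsilon> I d \<longleftrightarrow>
     (\<forall>n. graded_injective B (I n) \<and> graded_hom B (I n) (I (Suc n)) (d n)) \<and>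
     graded_hom B N (I 0) \<epsilon> \<and> inj_on \<epsilon> (mcarrier N) \<and>
     hom_kernel (I 0) (d 0) = \<epsilon> ` mcarrier N \<and>
     (\<forall>n. hom_kernel (I (Suc n)) (d (Suc n)) = d n ` mcarrier (I n))"

definition ext_cocycle ::
  "('k, 'b) gkalg \<Rightarrow> ('b, 'v::ab_group_add) gmod \<Rightarrow> (nat \<Rightarrow> ('b, 'k coords) gmod) \<Rightarrow>
   (nat \<Rightarrow> 'k coords \<Rightarrow> ('k::field) coords) \<Rightarrow> nat \<Rightarrow> ('v \<Rightarrow> 'k coords) \<Rightarrow> bool" where
  "ext_cocycle B M I d n f \<longleftrightarrow> graded_hom B M (I n) f \<and> (\<forall>x\<in>mcarrier M. d n (f x) = 0)"

definition ext_coboundary ::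
  "('k, 'b) gkalg \<Rightarrow> ('b, 'v::ab_group_add) gmod \<Rightarrow> (nat \<Rightarrow> ('b, 'k coords) gmod) \<Rightarrow>
   (nat \<Rightarrow> 'k coords \<Rightarrow> ('k::field) coords) \<Rightarrow> nat \<Rightarrow> ('v \<Rightarrow> 'k coords) \<Rightarrow> bool" where
  "ext_coboundary B M I d n f \<longleftrightarrow>
     (case n of
        0 \<Rightarrow> \<forall>x\<in>mcarrier M. f x = 0
      | Suc m \<Rightarrow> \<exists>g. graded_hom B M (I m) g \<and> (\<forall>x\<in>mcarrier M. f x = d m (g x)))"

text \<open>
  \<open>ext\<^sup>n(M, N) \<noteq> 0\<close>, where \<open>ext\<^sup>n(M, N)\<close> is the cocycles modulo the coboundaries of the
  complex \<open>hom(M, I)\<close> of degree-0 homomorphisms into an injective resolution \<open>I\<close> of \<open>N\<close>.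
  Finite-dimensional graded modules over a finite-dimensional graded algebra have
  finite-dimensional injective resolutions, and by the comparison theorem it does not matter
  which one is used.
\<close>

definition ext_nonzero ::
  "('k::field, 'b::ring) gkalg \<Rightarrow> nat \<Rightarrow> ('b, 'u::ab_group_add) gmod \<Rightarrow>
   ('b, 'v::ab_group_add) gmod \<Rightarrow> bool" where
  "ext_nonzero B n M N \<longleftrightarrow>
     (\<exists>\<epsilon> I d. injective_resolution B N \<epsilon> I d \<and>
        (\<exists>f. ext_cocycle B M I d n f \<and> \<not> ext_coboundary B M I d n f))"


section \<open>Q-Koszul algebras and Q-linear modules\<close>

definition q_koszul ::
  "('k::field, 'b::ring) gkalg \<Rightarrow> 'w::order set \<Rightarrow>
   ('w \<Rightarrow> ('b, 'd::ab_group_add) amod) \<Rightarrow> ('w \<Rightarrow> ('b, 'e::ab_group_add) amod) \<Rightarrow> bool" where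
  "q_koszul B \<Gamma> \<Delta> nabla \<longleftrightarrow>
     graded_algebra B \<and>
     quasi_hereditary (degree_zero_algebra B) \<Gamma> \<Delta> nabla \<and>
     (\<forall>n r. \<forall>\<gamma>\<in>\<Gamma>. \<forall>\<mu>\<in>\<Gamma>.
        ext_nonzero B n (inflate B (\<Delta> \<gamma>)) (shift r (inflate B (nabla \<mu>))) \<longrightarrow> int n = r)"

definition q_linear ::
  "('k::field, 'b::ring) gkalg \<Rightarrow> 'w set \<Rightarrow> ('w \<Rightarrow> ('b, 'e::ab_group_add) amod) \<Rightarrow>
   ('b, 'v::ab_group_add) gmod \<Rightarrow> bool" where
  "q_linear B \<Gamma> nabla M \<longleftrightarrow>
     graded_module B M \<and> nonneg_graded M \<and>
     (\<forall>n r. \<forall>\<gamma>\<in>\<Gamma>. ext_nonzero B n M (shift r (inflate B (nabla \<gamma>))) \<longrightarrow> int n = r)"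

end

theory Submission
  imports Defs
begin

text \<open>
  The truncations of \<open>M\<close> are linked by short exact sequences
  \<open>0 \<rightarrow> M\<^bsub>\<ge>j+1\<^esub> \<rightarrow> M\<^bsub>\<ge>j\<^esub> \<rightarrow> M\<^sub>j\<langle>j\<rangle> \<rightarrow> 0\<close>,
  where \<open>M\<^sub>j\<close> stands for the component inflated from \<open>B\<^sub>0\<close>. Let \<open>N = \<nabla>\<^sub>0(\<mu>)\<langle>s\<rangle>\<close>. As
  \<open>M\<^sub>j\<close> has a filtration by standard modules, the Q-Koszul property shows that
  \<open>ext\<^sup>m(M\<^sub>j\<langle>j\<rangle>, N)\<close> is concentrated in the single degree \<open>m = s - j\<close>.

  It has to be shown that \<open>ext\<^sup>n(M\<^bsub>\<ge>i\<^esub>, N) = 0\<close> unless \<open>n = s - i\<close>.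

  If \<open>n > s - i\<close>, then \<open>M\<^bsub>\<ge>i\<^esub>\<close> is an iterated extension of the modules
  \<open>M\<^sub>j\<langle>j\<rangle>\<close> with \<open>j \<ge> i\<close>, finitely many of which are nonzero, and \<open>ext\<^sup>n\<close> vanishes on each of
  them because \<open>n > s - j\<close> (\<open>ext_vanishes_truncation_above\<close>).

  If \<open>n < s - i\<close>, then \<open>ext\<^sup>n(M, N) = 0\<close> because \<open>M\<close> is Q-linear and \<open>n < s\<close>. Passing from
  \<open>M\<^bsub>\<ge>j\<^esub>\<close> to \<open>M\<^bsub>\<ge>j+1\<^esub>\<close> for \<open>j < i\<close>, the only obstruction
  lies in \<open>ext\<^sup>n\<^sup>+\<^sup>1(M\<^sub>j\<langle>j\<rangle>, N)\<close>, which vanishes because \<open>n + 1 < s - j\<close>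
  (\<open>ext_vanishes_truncation_below\<close>).

  Every Ext group here has the same second argument \<open>N\<close>, so all of them can be computed in one
  injective resolution of \<open>N\<close>. The parts of the long exact sequence that are used
  (\<open>ext_vanishes_extension\<close>, \<open>ext_vanishes_subobject\<close>) then follow by diagram chases from the
  lifting property of its terms. The main technical point is that this property is stated for
  modules inside \<open>k\<^sup>\<nat>\<close>; choosing bases extends it to finite-dimensional graded modules over
  arbitrary types (\<open>graded_injective_extend\<close>).
\<close>

section \<open>Finite-dimensional modules in coordinates\<close>

lemma add_subgroupD:
  assumes "add_subgroup U"
  shows add_subgroup_zero: "0 \<in> U"
    and add_subgroup_diff: "x \<in> U \<Longrightarrow> y \<in> U \<Longrightarrow> x - y \<in> U"
    and add_subgroup_minus: "x \<in> U \<Longrightarrow> - x \<in> U"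
    and add_subgroup_add: "x \<in> U \<Longrightarrow> y \<in> U \<Longrightarrow> x + y \<in> U"
proof -
  show zero: "0 \<in> U" and diff: "x \<in> U \<Longrightarrow> y \<in> U \<Longrightarrow> x - y \<in> U" for x y
    using assms by (auto simp: add_subgroup_def)
  show minus: "x \<in> U \<Longrightarrow> - x \<in> U" for x
    using diff[OF zero] by simp
  show "x \<in> U \<Longrightarrow> y \<in> U \<Longrightarrow> x + y \<in> U" for x y
    using diff[OF _ minus] by simp
qed

lemma add_subgroup_sum:
  assumes "add_subgroup U" "\<And>s. s \<in> S \<Longrightarrow> f s \<in> U"
  shows "sum f S \<in> U"
  using assms(2)
  by (induction S rule: infinite_finite_induct)
    (auto intro: add_subgroup_zero[OF assms(1)] add_subgroup_add[OF assms(1)])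

lemma additive_on_subgroup:
  assumes "add_subgroup U"
    and "\<And>x y. x \<in> U \<Longrightarrow> y \<in> U \<Longrightarrow> f (x + y) = f x + (f y :: 'b::ab_group_add)"
  shows additive_zero: "f 0 = 0"
    and additive_diff: "x \<in> U \<Longrightarrow> y \<in> U \<Longrightarrow> f (x - y) = f x - f y"
    and additive_sum: "(\<And>s. s \<in> S \<Longrightarrow> h s \<in> U) \<Longrightarrow> f (sum h S) = (\<Sum>s\<in>S. f (h s))"
proof -
  note U = add_subgroup_zero[OF assms(1)] add_subgroup_minus[OF assms(1)]
  show zero: "f 0 = 0"
    using assms(2)[OF U(1) U(1)] by simp
  have minus: "f (- x) = - f x" if "x \<in> U" for x
    using assms(2)[OF that U(2)[OF that]] zero by (simp add: eq_neg_iff_add_eq_0 add.commute)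
  show "f (x - y) = f x - f y" if "x \<in> U" "y \<in> U" for x y
    using assms(2)[OF that(1) U(2)[OF that(2)]] minus that by simp
  show "(\<And>s. s \<in> S \<Longrightarrow> h s \<in> U) \<Longrightarrow> f (sum h S) = (\<Sum>s\<in>S. f (h s))"
    by (induction S rule: infinite_finite_induct)
      (auto simp: zero assms(2) add_subgroup_sum[OF assms(1)])
qed

locale algebra =
  fixes A :: "('k::field, 'b::ring, 'z) kalg_scheme"
  assumes alg: "fd_algebra A"
begin

abbreviation scalar :: "'k \<Rightarrow> 'b" where
  "scalar c \<equiv> ascale A c (aone A)"

lemma vs: "vector_space (ascale A)" and subspace: "module.subspace (ascale A) (acarrier A)"
  using alg by (simp_all add: fd_algebra_def)

lemma module_scale: "module (ascale A)"
  using vs by (simp add: module_iff_vector_space)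

lemma acarrier_subgroup: "add_subgroup (acarrier A)"
  using module.subspace_0[OF module_scale subspace] module.subspace_diff[OF module_scale subspace]
  by (simp add: add_subgroup_def)

lemma mult_closed: "a \<in> acarrier A \<Longrightarrow> b \<in> acarrier A \<Longrightarrow> a * b \<in> acarrier A"
  using alg by (simp add: fd_algebra_def)

lemma scalar_closed [simp]: "scalar c \<in> acarrier A"
  using alg module.subspace_scale[OF module_scale subspace] by (simp add: fd_algebra_def)

lemma scalar_simps:
  "scalar (c + d) = scalar c + scalar d" "scalar (c * d) = scalar c * scalar d"
  "scalar 1 = aone A" "scalar 0 = 0"
proof -
  show "scalar (c + d) = scalar c + scalar d"
    using module.scale_left_distrib[OF module_scale] by blast
  have "scalar c * scalar d = ascale A c (aone A * scalar d)"
    using alg unfolding fd_algebra_def by metis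
  also have "\<dots> = ascale A c (scalar d)"
    using alg scalar_closed unfolding fd_algebra_def by metis
  finally show "scalar (c * d) = scalar c * scalar d"
    using module.scale_scale[OF module_scale] by simp
  show "scalar 1 = aone A" "scalar 0 = 0"
    using module.scale_one[OF module_scale] module.scale_zero_left[OF module_scale] by auto
qed

end

locale module_over = algebra A
  for A :: "('k::field, 'b::ring, 'z) kalg_scheme" +
  fixes M :: "('b, 'v::ab_group_add, 'y) amod_scheme"
  assumes fdm: "fd_module A M"
begin

lemma mcarrier_subgroup: "add_subgroup (mcarrier M)"
  using fdm by (simp add: fd_module_def)

lemmas zero_mem [simp] = add_subgroup_zero[OF mcarrier_subgroup]
  and add_mem = add_subgroup_add[OF mcarrier_subgroup]
  and diff_mem = add_subgroup_diff[OF mcarrier_subgroup]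
  and sum_mem = add_subgroup_sum[OF mcarrier_subgroup]

lemma act_closed [simp]: "a \<in> acarrier A \<Longrightarrow> x \<in> mcarrier M \<Longrightarrow> act M a x \<in> mcarrier M"
  and act_add: "a \<in> acarrier A \<Longrightarrow> x \<in> mcarrier M \<Longrightarrow> y \<in> mcarrier M \<Longrightarrow>
    act M a (x + y) = act M a x + act M a y"
  and act_add_left: "a \<in> acarrier A \<Longrightarrow> b \<in> acarrier A \<Longrightarrow> x \<in> mcarrier M \<Longrightarrow>
    act M (a + b) x = act M a x + act M b x"
  and act_mult: "a \<in> acarrier A \<Longrightarrow> b \<in> acarrier A \<Longrightarrow> x \<in> mcarrier M \<Longrightarrow>
    act M (a * b) x = act M a (act M b x)"
  and act_one: "x \<in> mcarrier M \<Longrightarrow> act M (aone A) x = x"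
  using fdm by (simp_all add: fd_module_def)

lemma act_zero: "a \<in> acarrier A \<Longrightarrow> act M a 0 = 0"
  and act_diff: "a \<in> acarrier A \<Longrightarrow> x \<in> mcarrier M \<Longrightarrow> y \<in> mcarrier M \<Longrightarrow>
    act M a (x - y) = act M a x - act M a y"
  and act_sum: "a \<in> acarrier A \<Longrightarrow> (\<And>s. s \<in> S \<Longrightarrow> h s \<in> mcarrier M) \<Longrightarrow>
    act M a (sum h S) = (\<Sum>s\<in>S. act M a (h s))"
  by (simp_all add: additive_on_subgroup[OF mcarrier_subgroup, of "act M a"] act_add)

lemma act_zero_left: "x \<in> mcarrier M \<Longrightarrow> act M 0 x = 0"
  and act_sum_left: "x \<in> mcarrier M \<Longrightarrow> (\<And>s. s \<in> S \<Longrightarrow> k s \<in> acarrier A) \<Longrightarrow>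
    act M (sum k S) x = (\<Sum>s\<in>S. act M (k s) x)"
  by (simp_all add: additive_on_subgroup[OF acarrier_subgroup, of "\<lambda>a. act M a x"] act_add_left)

definition combination :: "('v \<Rightarrow> 'k) \<Rightarrow> 'v set \<Rightarrow> 'v" where
  "combination c S = (\<Sum>s\<in>S. act M (scalar (c s)) s)"

lemma combination_mem: "S \<subseteq> mcarrier M \<Longrightarrow> combination c S \<in> mcarrier M"
  unfolding combination_def by (rule sum_mem) auto

lemma combination_add:
  "S \<subseteq> mcarrier M \<Longrightarrow> combination (\<lambda>s. c s + d s) S = combination c S + combination d S"
  unfolding combination_def sum.distrib[symmetric]
  by (intro sum.cong refl) (auto simp: scalar_simps act_add_left)

lemma combination_scale:
  assumes "S \<subseteq> mcarrier M"
  shows "combination (\<lambda>s. a * c s) S = act M (scalar a) (combination c S)"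
proof -
  have "act M (scalar a) (combination c S) = (\<Sum>s\<in>S. act M (scalar a) (act M (scalar (c s)) s))"
    unfolding combination_def by (rule act_sum) (use assms in auto)
  also have "\<dots> = combination (\<lambda>s. a * c s) S"
    unfolding combination_def using assms
    by (intro sum.cong refl) (auto simp: scalar_simps act_mult)
  finally show ?thesis ..
qed

text \<open>
  A spanning set of least cardinality is a basis: from a nontrivial relation one of its elements
  could be solved for and dropped.
\<close>

lemma basis_ex:
  obtains S where "finite S" "S \<subseteq> mcarrier M"
    "\<And>x. x \<in> mcarrier M \<Longrightarrow> \<exists>c. x = combination c S"
    "\<And>c s. combination c S = 0 \<Longrightarrow> s \<in> S \<Longrightarrow> c s = 0"
proof -
  define spans where "spans S \<longleftrightarrow> finite S \<and> S \<subseteq> mcarrier M \<and>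
    (\<forall>x\<in>mcarrier M. \<exists>c. x = combination c S)" for S
  have "\<exists>S. spans S"
    using fdm by (simp add: fd_module_def spans_def combination_def)
  then obtain S where S: "spans S" and least: "\<And>T. spans T \<Longrightarrow> card S \<le> card T"
    using ex_has_least_nat[of spans _ card] by metis
  have fin: "finite S" and sub: "S \<subseteq> mcarrier M"
    using S by (auto simp: spans_def)
  have "c t = 0" if rel: "combination c S = 0" and t: "t \<in> S" for c t
  proof (rule ccontr)
    assume ct: "c t \<noteq> 0"
    have "spans (S - {t})"
      unfolding spans_def
    proof (intro conjI ballI)
      show "finite (S - {t})" "S - {t} \<subseteq> mcarrier M"
        using fin sub by auto
      fix x assume "x \<in> mcarrier M"
      then obtain d where d: "x = combination d S"
        using S by (auto simp: spans_def)
      \<comment> \<open>Adding this multiple of the relation makes the coefficient of \<open>t\<close> zero.\<close>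
      define k where "k = - d t / c t"
      have "x = combination (\<lambda>s. d s + k * c s) S"
        using combination_add[OF sub, of d "\<lambda>s. k * c s"] combination_scale[OF sub, of k c] d rel
        by (simp add: act_zero)
      also have "\<dots> = combination (\<lambda>s. d s + k * c s) (S - {t})"
        unfolding combination_def using fin t ct sub
        by (subst sum.remove[of S t]) (auto simp: k_def scalar_simps act_zero_left)
      finally show "\<exists>e. x = combination e (S - {t})" by blast
    qed
    then have "card S \<le> card (S - {t})"
      by (rule least)
    with fin t show False
      by (metis card_Diff1_less linorder_not_less)
  qed
  with that[of S] S show thesis
    by (auto simp: spans_def)
qed

text \<open>
  Modules live on subsets of arbitrary types, whereas injectivity is tested on modules inside
  \<open>k\<^sup>\<nat>\<close>; coordinates with respect to a basis mediate between the two.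
\<close>

lemma coordinates_ex:
  obtains e :: "'v \<Rightarrow> 'k coords" and N where
    "inj_on e (mcarrier M)"
    "\<And>x y. x \<in> mcarrier M \<Longrightarrow> y \<in> mcarrier M \<Longrightarrow> e (x + y) = e x + e y"
    "\<And>c x. x \<in> mcarrier M \<Longrightarrow> e (act M (scalar c) x) = (\<lambda>n. c * e x n)"
    "\<And>x n. x \<in> mcarrier M \<Longrightarrow> n \<ge> N \<Longrightarrow> e x n = 0"
proof -
  obtain S where S: "finite S" "S \<subseteq> mcarrier M"
    and span: "\<And>x. x \<in> mcarrier M \<Longrightarrow> \<exists>c. x = combination c S"
    and indep: "\<And>c s. combination c S = 0 \<Longrightarrow> s \<in> S \<Longrightarrow> c s = 0"
    using basis_ex by blast
  have unique: "c s = d s" if "combination c S = combination d S" "s \<in> S" for c d s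
  proof -
    have "combination (\<lambda>s. c s + (-1) * d s) S = act M (scalar (1 + (-1))) (combination d S)"
      unfolding scalar_simps act_add_left[OF scalar_closed[of 1, unfolded scalar_simps(3)]
          scalar_closed combination_mem[OF S(2)]]
      using combination_add[OF S(2), of c "\<lambda>s. (-1) * d s"]
        combination_scale[OF S(2), of "-1" d] that(1) combination_mem[OF S(2), of d]
      by (simp add: act_one)
    also have "\<dots> = 0"
      using combination_mem[OF S(2), of d] by (simp add: scalar_simps act_zero_left)
    finally show ?thesis
      using indep[of "\<lambda>s. c s + (-1) * d s" s] that(2) by simp
  qed
  from span obtain coeff where coeff: "\<And>x. x \<in> mcarrier M \<Longrightarrow> x = combination (coeff x) S"
    by metis
  obtain h where h: "bij_betw h {..<card S} S"
    using ex_bij_betw_nat_finite[OF S(1)] by (auto simp: atLeast0LessThan)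
  have hS: "h n \<in> S" if "n < card S" for n
    using h that by (auto simp: bij_betw_def)
  define e where "e x n = (if n < card S then coeff x (h n) else 0)" for x n
  show thesis
  proof (rule that[of e "card S"])
    show "inj_on e (mcarrier M)"
    proof (rule inj_onI)
      fix x y assume xy: "x \<in> mcarrier M" "y \<in> mcarrier M" "e x = e y"
      have "coeff x s = coeff y s" if "s \<in> S" for s
      proof -
        obtain n where "n < card S" "h n = s"
          using h \<open>s \<in> S\<close> by (metis bij_betw_imp_surj_on imageE lessThan_iff)
        with fun_cong[OF xy(3), of n] show ?thesis
          by (simp add: e_def)
      qed
      then have "combination (coeff x) S = combination (coeff y) S"
        by (simp add: combination_def)
      with coeff xy(1,2) show "x = y"
        by metis
    qed
    fix x assume x: "x \<in> mcarrier M"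
    show "e x n = 0" if "n \<ge> card S" for n
      using that by (simp add: e_def)
    have "coeff (act M (scalar c) x) s = c * coeff x s" if "s \<in> S" for s c
      using coeff[of "act M (scalar c) x"] coeff[OF x] x combination_scale[OF S(2), of c "coeff x"]
      by (intro unique[OF _ that]) simp
    then show "e (act M (scalar c) x) = (\<lambda>n. c * e x n)" for c
      by (auto simp: e_def hS)
    fix y assume y: "y \<in> mcarrier M"
    have "coeff (x + y) s = coeff x s + coeff y s" if "s \<in> S" for s
      using coeff[OF add_mem[OF x y]] coeff[OF x] coeff[OF y]
        combination_add[OF S(2), of "coeff x" "coeff y"]
      by (intro unique[OF _ that]) simp
    then show "e (x + y) = e x + e y"
      by (auto simp: e_def hS)
  qed
qed

end

lemma sum_fun_apply: "(\<Sum>s\<in>S. f s) n = (\<Sum>s\<in>S. f s n)"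
  by (induction S rule: infinite_finite_induct) auto

text \<open>
  Finite generation of submodules is the statement that a subspace of a finite-dimensional
  space is finite-dimensional, applied to the image in coordinates.
\<close>

lemma submodule_fd_module:
  fixes A :: "('k::field, 'b::ring, 'z) kalg_scheme"
    and M :: "('b, 'v::ab_group_add, 'y) amod_scheme"
  assumes A: "fd_algebra A" and M: "fd_module A M" and U: "submodule A M U"
  shows "fd_module A (M\<lparr>mcarrier := U\<rparr>)"
proof -
  interpret module_over A M
    using A M by unfold_locales
  have sub: "U \<subseteq> mcarrier M" and Ug: "add_subgroup U"
    and Ua: "\<And>a x. a \<in> acarrier A \<Longrightarrow> x \<in> U \<Longrightarrow> act M a x \<in> U"
    using U by (auto simp: submodule_def)
  obtain e :: "'v \<Rightarrow> 'k coords" and N where inj: "inj_on e (mcarrier M)"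
    and add: "\<And>x y. x \<in> mcarrier M \<Longrightarrow> y \<in> mcarrier M \<Longrightarrow> e (x + y) = e x + e y"
    and scale: "\<And>c x. x \<in> mcarrier M \<Longrightarrow> e (act M (scalar c) x) = (\<lambda>n. c * e x n)"
    and bound: "\<And>x n. x \<in> mcarrier M \<Longrightarrow> n \<ge> N \<Longrightarrow> e x n = 0"
    using coordinates_ex by blast
  interpret V: vector_space "\<lambda>(c::'k) (f::'k coords) n. c * f n"
    by unfold_locales (auto simp: fun_eq_iff algebra_simps)
  \<comment> \<open>The coordinates beyond \<open>N\<close> are zero, so the image of \<open>U\<close> is spanned within \<open>k\<^sup>N\<close>.\<close>
  define unit :: "nat \<Rightarrow> 'k coords" where "unit i = (\<lambda>n. if n = i then 1 else 0)" for i
  have "f \<in> V.span (unit ` {..<N})" if f: "\<And>n. n \<ge> N \<Longrightarrow> f n = 0" for f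
  proof -
    have "(\<Sum>i<N. f i * unit i n) = f n" for n
      using f[of n] by (cases "n < N") (auto simp: unit_def if_distrib cong: if_cong)
    then have "f = (\<Sum>i<N. (\<lambda>n. f i * unit i n))"
      by (simp add: fun_eq_iff sum_fun_apply)
    also have "\<dots> \<in> V.span (unit ` {..<N})"
      by (intro V.span_sum V.span_scale V.span_base) auto
    finally show ?thesis .
  qed
  then have in_span: "e ` U \<subseteq> V.span (unit ` {..<N})"
    using bound sub by blast
  obtain T where T: "T \<subseteq> e ` U" "V.independent T" "e ` U \<subseteq> V.span T"
    using V.maximal_independent_subset by blast
  have "finite T"
    using V.independent_span_bound[OF _ T(2), of "unit ` {..<N}"] T(1) in_span by auto
  obtain S where S: "S \<subseteq> U" "T = e ` S" "inj_on e S"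
    using T(1) by (meson subset_image_inj)
  have "finite S"
    using \<open>finite T\<close> S by (metis finite_imageD)
  have "\<exists>c. x = combination c S" if x: "x \<in> U" for x
  proof -
    have "e x \<in> V.span T"
      using T(3) x by auto
    then obtain u where "e x = (\<Sum>t\<in>T. (\<lambda>n. u t * t n))"
      using V.span_finite[OF \<open>finite T\<close>] by auto
    also have "\<dots> = (\<Sum>s\<in>S. e (act M (scalar (u (e s))) s))"
      using S sub by (auto simp: sum.reindex scale intro!: sum.cong)
    also have "\<dots> = e (combination (\<lambda>s. u (e s)) S)"
      unfolding combination_def using S(1) sub
      by (intro additive_sum[OF mcarrier_subgroup add, symmetric]) auto
    finally have "x = combination (\<lambda>s. u (e s)) S"
      using inj x sub combination_mem S(1) by (meson inj_onD subset_iff subset_trans)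
    then show ?thesis by blast
  qed
  then have "\<exists>S. finite S \<and> S \<subseteq> U \<and> (\<forall>x\<in>U. \<exists>c. x = (\<Sum>s\<in>S. act M (scalar (c s)) s))"
    using \<open>finite S\<close> S(1) unfolding combination_def by blast
  then show ?thesis
    unfolding fd_module_def using Ug Ua sub
    by (auto simp: subset_iff act_add act_add_left act_mult act_one)
qed

section \<open>Homogeneous parts\<close>

definition homogeneous_part :: "('i \<Rightarrow> 'v::ab_group_add set) \<Rightarrow> 'v \<Rightarrow> 'i \<Rightarrow> 'v" where
  "homogeneous_part C x = (THE f. graded_decomp C x f)"

lemma degree_zero_part_eq: "degree_zero_part B b = homogeneous_part (agr B) b 0"
  by (simp add: degree_zero_part_def homogeneous_part_def)

lemma graded_decompI:
  assumes "\<And>i. f i \<in> C i" "finite F" "\<And>i. i \<notin> F \<Longrightarrow> f i = 0" "x = sum f F"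
  shows "graded_decomp C x f"
proof -
  have "{i. f i \<noteq> 0} \<subseteq> F"
    using assms(3) by blast
  moreover have "sum f {i. f i \<noteq> 0} = sum f F"
    by (rule sum.mono_neutral_left) (use assms in auto)
  ultimately show ?thesis
    using assms finite_subset unfolding graded_decomp_def by auto
qed

lemma graded_decomp_sum:
  assumes "graded_decomp C x f" "finite F" "\<And>i. i \<notin> F \<Longrightarrow> f i = 0"
  shows "x = sum f F"
proof -
  have "sum f {i. f i \<noteq> 0} = sum f F"
    by (rule sum.mono_neutral_left) (use assms in auto)
  then show ?thesis
    using assms(1) by (simp add: graded_decomp_def)
qed

lemma graded_decomp_mem: "graded_decomp C x f \<Longrightarrow> f i \<in> C i"
  and graded_decomp_finite: "graded_decomp C x f \<Longrightarrow> finite {i. f i \<noteq> 0}"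
  by (simp_all add: graded_decomp_def)

locale direct_sum =
  fixes V :: "'v::ab_group_add set" and C :: "'i \<Rightarrow> 'v set"
  assumes ds: "direct_sum_of V C"
begin

lemma comp_subgroup: "add_subgroup (C i)" and comp_sub: "x \<in> C i \<Longrightarrow> x \<in> V"
  using ds by (auto simp: direct_sum_of_def)

lemmas comp_zero [simp] = add_subgroup_zero[OF comp_subgroup]

lemma decomp_ex1: "x \<in> V \<Longrightarrow> \<exists>!f. graded_decomp C x f"
  using ds unfolding direct_sum_of_def by blast

lemma decomp: "x \<in> V \<Longrightarrow> graded_decomp C x (homogeneous_part C x)"
  unfolding homogeneous_part_def by (rule theI'[OF decomp_ex1])

lemma decomp_unique: "x \<in> V \<Longrightarrow> graded_decomp C x f \<Longrightarrow> homogeneous_part C x = f"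
  unfolding homogeneous_part_def by (rule the1_equality[OF decomp_ex1])

lemmas part_mem [simp] = graded_decomp_mem[OF decomp]
  and part_finite [simp] = graded_decomp_finite[OF decomp]
  and part_sum = graded_decomp_sum[OF decomp]

lemma part_add:
  assumes "x \<in> V" "y \<in> V" "x + y \<in> V"
  shows "homogeneous_part C (x + y) i = homogeneous_part C x i + homogeneous_part C y i"
proof -
  let ?F = "{i. homogeneous_part C x i \<noteq> 0} \<union> {i. homogeneous_part C y i \<noteq> 0}"
  have "graded_decomp C (x + y) (\<lambda>i. homogeneous_part C x i + homogeneous_part C y i)"
  proof (rule graded_decompI[of _ _ ?F])
    show "homogeneous_part C x i + homogeneous_part C y i \<in> C i" for i
      by (simp add: assms add_subgroup_add[OF comp_subgroup])
    show "x + y = (\<Sum>i\<in>?F. homogeneous_part C x i + homogeneous_part C y i)"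
      unfolding sum.distrib by (intro arg_cong2[of _ _ _ _ "(+)"] part_sum) (auto simp: assms)
  qed (auto simp: assms)
  from decomp_unique[OF assms(3) this] show ?thesis
    by simp
qed

lemma part_homogeneous:
  assumes "x \<in> C i"
  shows "homogeneous_part C x j = (if j = i then x else 0)"
proof -
  have "graded_decomp C x (\<lambda>j. if j = i then x else 0)"
    by (rule graded_decompI[of _ _ "{i}"]) (auto simp: assms)
  from decomp_unique[OF comp_sub[OF assms] this] show ?thesis
    by simp
qed

lemma eq_zeroI: "x \<in> V \<Longrightarrow> (\<And>i. homogeneous_part C x i = 0) \<Longrightarrow> x = 0"
  using part_sum[of x "{}"] by simp

end

lemma direct_sum_of_concentrated:
  assumes "add_subgroup V"
  shows "direct_sum_of V (\<lambda>i. if i = k then V else {0})"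
  unfolding direct_sum_of_def
proof (intro conjI allI ballI)
  fix x assume x: "x \<in> V"
  show "\<exists>!f. graded_decomp (\<lambda>i. if i = k then V else {0}) x f"
  proof (rule ex1I)
    show "graded_decomp (\<lambda>i. if i = k then V else {0}) x (\<lambda>i. if i = k then x else 0)"
      by (rule graded_decompI[of _ _ "{k}"]) (auto simp: x)
    fix f assume f: "graded_decomp (\<lambda>i. if i = k then V else {0}) x f"
    have off: "f i = 0" if "i \<noteq> k" for i
      using graded_decomp_mem[OF f, of i] that by simp
    have "x = f k"
      using graded_decomp_sum[OF f, of "{k}"] off by simp
    with off show "f = (\<lambda>i. if i = k then x else 0)"
      by auto
  qed
qed (use assms in \<open>auto simp: add_subgroup_def\<close>)

text \<open>
  A subgroup that contains the homogeneous parts of its elements, and whose components are full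
  or zero, inherits the grading. Truncations are of this kind.
\<close>

lemma direct_sum_of_restrict:
  assumes "direct_sum_of V C" and "U \<subseteq> V"
    and "\<And>i. D i = C i \<or> D i = {0}" and "\<And>i. D i \<subseteq> U"
    and "\<And>x i. x \<in> U \<Longrightarrow> homogeneous_part C x i \<in> D i"
  shows "direct_sum_of U D"
  unfolding direct_sum_of_def
proof (intro conjI allI ballI)
  interpret direct_sum V C
    using assms(1) by unfold_locales
  have sub: "D i \<subseteq> C i" for i
    using assms(3)[of i] by auto
  show "add_subgroup (D i)" for i
    using assms(3)[of i] comp_subgroup[of i] by (auto simp: add_subgroup_def)
  show "D i \<subseteq> U" for i
    by (rule assms(4))
  fix x assume x: "x \<in> U"
  then have dec: "graded_decomp C x (homogeneous_part C x)"
    using assms(2) decomp by blast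
  show "\<exists>!f. graded_decomp D x f"
  proof (rule ex1I)
    show "graded_decomp D x (homogeneous_part C x)"
      using dec assms(5)[OF x] by (simp add: graded_decomp_def)
    fix f assume "graded_decomp D x f"
    then have "graded_decomp C x f"
      using sub by (auto simp: graded_decomp_def)
    then show "f = homogeneous_part C x"
      using decomp_unique x assms(2) by blast
  qed
qed

lemma graded_decomp_shift:
  fixes C :: "int \<Rightarrow> 'v::ab_group_add set"
  assumes "graded_decomp C x f"
  shows "graded_decomp (\<lambda>i. C (i - r)) x (\<lambda>i. f (i - r))"
proof (rule graded_decompI[of _ _ "(\<lambda>i. i + r) ` {i. f i \<noteq> 0}"])
  show "f (i - r) = 0" if "i \<notin> (\<lambda>i. i + r) ` {i. f i \<noteq> 0}" for i
    using that by (metis (mono_tags, lifting) diff_add_cancel image_eqI mem_Collect_eq)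
  show "x = (\<Sum>i\<in>(\<lambda>i. i + r) ` {i. f i \<noteq> 0}. f (i - r))"
    using assms by (simp add: sum.reindex graded_decomp_def)
qed (use assms in \<open>simp_all add: graded_decomp_def\<close>)

lemma direct_sum_of_shift:
  fixes C :: "int \<Rightarrow> 'v::ab_group_add set"
  assumes "direct_sum_of V C"
  shows "direct_sum_of V (\<lambda>i. C (i - r))"
proof -
  interpret direct_sum V C
    using assms by unfold_locales
  have "\<exists>!f. graded_decomp (\<lambda>i. C (i - r)) x f" if "x \<in> V" for x
  proof (rule ex1I)
    show "graded_decomp (\<lambda>i. C (i - r)) x (\<lambda>i. homogeneous_part C x (i - r))"
      by (rule graded_decomp_shift[OF decomp[OF that]])
    fix g assume "graded_decomp (\<lambda>i. C (i - r)) x g"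
    from graded_decomp_shift[OF this, of "- r"] have "homogeneous_part C x = (\<lambda>i. g (i + r))"
      by (intro decomp_unique[OF that]) simp
    then show "g = (\<lambda>i. homogeneous_part C x (i - r))"
      by simp
  qed
  moreover have "\<forall>i. add_subgroup (C (i - r)) \<and> C (i - r) \<subseteq> V"
    using comp_subgroup comp_sub by blast
  ultimately show ?thesis
    unfolding direct_sum_of_def by blast
qed

section \<open>Graded algebras and graded modules\<close>

locale graded_alg =
  fixes B :: "('k::field, 'b::ring) gkalg"
  assumes galg: "graded_algebra B"

sublocale graded_alg \<subseteq> algebra B
  using galg by unfold_locales (simp add: graded_algebra_def)

sublocale graded_alg \<subseteq> agr: direct_sum "acarrier B" "agr B"
  using galg by unfold_locales (simp add: graded_algebra_def)

lemma (in graded_alg) scalar_degree_zero: "scalar c \<in> agr B 0"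
  using galg module.subspace_scale[OF module_scale] by (simp add: graded_algebra_def)

locale graded_module_over = graded_alg B
  for B :: "('k::field, 'b::ring) gkalg" +
  fixes M :: "('b, 'v::ab_group_add) gmod"
  assumes gmod: "graded_module B M"

sublocale graded_module_over \<subseteq> module_over B M
  using gmod by unfold_locales (simp add: graded_module_def)

sublocale graded_module_over \<subseteq> direct_sum "mcarrier M" "gcomp M"
  using gmod by unfold_locales (simp add: graded_module_def)

context graded_module_over
begin

lemma act_gcomp: "b \<in> agr B n \<Longrightarrow> x \<in> gcomp M i \<Longrightarrow> act M b x \<in> gcomp M (int n + i)"
  using gmod by (simp add: graded_module_def)

text \<open>
  Expanding both arguments into homogeneous parts, the terms of degree \<open>j\<close> pair degree \<open>n\<close>
  in the algebra with degree \<open>j - n\<close> in the module.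
\<close>

lemma part_act:
  assumes b: "b \<in> acarrier B" and x: "x \<in> mcarrier M"
  shows "homogeneous_part (gcomp M) (act M b x) j =
    (\<Sum>n | homogeneous_part (agr B) b n \<noteq> 0.
      act M (homogeneous_part (agr B) b n) (homogeneous_part (gcomp M) x (j - int n)))"
proof -
  define c where "c = homogeneous_part (agr B) b"
  define y where "y = homogeneous_part (gcomp M) x"
  define F where "F = {n. c n \<noteq> 0}"
  define G where "G = {i. y i \<noteq> 0}"
  define H where "H = (\<lambda>(n, i). int n + i) ` (F \<times> G)"
  have fin: "finite F" "finite G"
    unfolding F_def G_def c_def y_def using b x by simp_all
  have c: "c n \<in> agr B n" "c n \<in> acarrier B" for n
    unfolding c_def using b agr.comp_sub by (auto intro: agr.part_mem)
  have y: "y i \<in> gcomp M i" "y i \<in> mcarrier M" for i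
    unfolding y_def using x comp_sub by (auto intro: part_mem)
  have xsum: "(\<Sum>j\<in>H. y (j - int n)) = x" if "n \<in> F" for n
  proof -
    have "(\<Sum>j\<in>H. y (j - int n)) = sum y ((\<lambda>j. j - int n) ` H)"
      by (simp add: sum.reindex inj_on_def)
    also have "\<dots> = x"
      unfolding y_def
    proof (rule part_sum[OF x, symmetric])
      show "finite ((\<lambda>j. j - int n) ` H)"
        unfolding H_def using fin by simp
      have "i \<in> (\<lambda>j. j - int n) ` H" if "y i \<noteq> 0" for i
        unfolding H_def using that \<open>n \<in> F\<close> by (force simp: G_def)
      then show "i \<notin> (\<lambda>j. j - int n) ` H \<Longrightarrow> homogeneous_part (gcomp M) x i = 0" for i
        by (auto simp: y_def)
    qed
    finally show ?thesis .
  qed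
  have "graded_decomp (gcomp M) (act M b x) (\<lambda>j. \<Sum>n\<in>F. act M (c n) (y (j - int n)))"
  proof (rule graded_decompI[of _ _ H])
    fix j
    show "(\<Sum>n\<in>F. act M (c n) (y (j - int n))) \<in> gcomp M j"
    proof (rule add_subgroup_sum[OF comp_subgroup])
      show "act M (c n) (y (j - int n)) \<in> gcomp M j" for n
        using act_gcomp[OF c(1) y(1), of n "j - int n"] by simp
    qed
    assume "j \<notin> H"
    then have "y (j - int n) = 0" if "n \<in> F" for n
      using that unfolding H_def by (force simp: G_def)
    then show "(\<Sum>n\<in>F. act M (c n) (y (j - int n))) = 0"
      using c by (simp add: act_zero)
  next
    have "act M b x = act M (\<Sum>n\<in>F. c n) x"
      unfolding c_def F_def by (subst agr.part_sum[OF b, symmetric]) (auto simp: b)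
    also have "\<dots> = (\<Sum>n\<in>F. act M (c n) x)"
      using c x by (simp add: act_sum_left)
    also have "\<dots> = (\<Sum>n\<in>F. \<Sum>j\<in>H. act M (c n) (y (j - int n)))"
      using xsum c y by (intro sum.cong refl) (simp add: act_sum[symmetric])
    also have "\<dots> = (\<Sum>j\<in>H. \<Sum>n\<in>F. act M (c n) (y (j - int n)))"
      by (rule sum.swap)
    finally show "act M b x = (\<Sum>j\<in>H. \<Sum>n\<in>F. act M (c n) (y (j - int n)))" .
  qed (use fin in \<open>simp add: H_def\<close>)
  then show ?thesis
    using decomp_unique[of "act M b x"] b x unfolding c_def y_def F_def by simp
qed

lemma part_act_degree_zero:
  assumes b: "b \<in> agr B 0" and x: "x \<in> mcarrier M"
  shows "homogeneous_part (gcomp M) (act M b x) j = act M b (homogeneous_part (gcomp M) x j)"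
proof (cases "b = 0")
  case True
  then show ?thesis
    using x comp_sub[OF part_mem[OF x]] part_homogeneous[OF comp_zero]
    by (simp add: act_zero_left)
next
  case False
  then have "{n. homogeneous_part (agr B) b n \<noteq> 0} = {0}"
    using agr.part_homogeneous[OF b] by auto
  then show ?thesis
    using part_act[OF agr.comp_sub[OF b] x] agr.part_homogeneous[OF b] by simp
qed

lemma part_sum_fun:
  assumes "\<And>s. s \<in> S \<Longrightarrow> h s \<in> mcarrier M"
  shows "homogeneous_part (gcomp M) (sum h S) j = (\<Sum>s\<in>S. homogeneous_part (gcomp M) (h s) j)"
  using assms by (intro additive_sum[OF mcarrier_subgroup]) (auto simp: part_add add_mem)

text \<open>
  The scalars have degree zero, so no element reaches a degree that is not reached by one of
  finitely many generators.
\<close>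

lemma degrees_bounded_above:
  obtains k :: int where "\<And>x j. x \<in> mcarrier M \<Longrightarrow> j \<ge> k \<Longrightarrow> homogeneous_part (gcomp M) x j = 0"
proof -
  obtain S where S: "finite S" "S \<subseteq> mcarrier M"
    and span: "\<And>x. x \<in> mcarrier M \<Longrightarrow> \<exists>c. x = combination c S"
    by (rule basis_ex) (rule that)
  define D where "D = (\<Union>s\<in>S. {j. homogeneous_part (gcomp M) s j \<noteq> 0})"
  have "finite D"
    unfolding D_def using S by auto
  define k where "k = Max (insert 0 D) + 1"
  have k: "j < k" if "j \<in> D" for j
    using Max_ge[of "insert 0 D" j] that \<open>finite D\<close> by (simp add: k_def)
  show thesis
  proof (rule that[of k])
    fix x j assume x: "x \<in> mcarrier M" and j: "j \<ge> k"
    obtain c where "x = combination c S"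
      using span[OF x] by blast
    then have "homogeneous_part (gcomp M) x j =
        (\<Sum>s\<in>S. act M (scalar (c s)) (homogeneous_part (gcomp M) s j))"
      unfolding combination_def using S(2)
      by (simp add: part_sum_fun subset_iff part_act_degree_zero[OF scalar_degree_zero])
    also have "\<dots> = 0"
    proof (rule sum.neutral, rule ballI)
      fix s assume "s \<in> S"
      then have "homogeneous_part (gcomp M) s j = 0"
        using k[of j] j by (auto simp: D_def)
      then show "act M (scalar (c s)) (homogeneous_part (gcomp M) s j) = 0"
        by (simp add: act_zero)
    qed
    finally show "homogeneous_part (gcomp M) x j = 0" .
  qed
qed

end

section \<open>Graded homomorphisms\<close>

lemma graded_homD:
  assumes "graded_hom B M N f"
  shows graded_hom_mem: "x \<in> mcarrier M \<Longrightarrow> f x \<in> mcarrier N"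
    and graded_hom_add: "x \<in> mcarrier M \<Longrightarrow> y \<in> mcarrier M \<Longrightarrow> f (x + y) = f x + f y"
    and graded_hom_act: "a \<in> acarrier B \<Longrightarrow> x \<in> mcarrier M \<Longrightarrow> f (act M a x) = act N a (f x)"
    and graded_hom_gcomp: "x \<in> gcomp M i \<Longrightarrow> f x \<in> gcomp N i"
  using assms by (simp_all add: graded_hom_def mod_hom_def image_subset_iff)

lemma graded_homI:
  assumes "\<And>x. x \<in> mcarrier M \<Longrightarrow> f x \<in> mcarrier N"
    and "\<And>x y. x \<in> mcarrier M \<Longrightarrow> y \<in> mcarrier M \<Longrightarrow> f (x + y) = f x + f y"
    and "\<And>a x. a \<in> acarrier B \<Longrightarrow> x \<in> mcarrier M \<Longrightarrow> f (act M a x) = act N a (f x)"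
    and "\<And>x i. x \<in> gcomp M i \<Longrightarrow> f x \<in> gcomp N i"
  shows "graded_hom B M N f"
  using assms by (auto simp: graded_hom_def mod_hom_def)

lemma graded_hom_comp:
  assumes "graded_hom B L M f" "graded_hom B M N g"
  shows "graded_hom B L N (\<lambda>x. g (f x))"
  by (rule graded_homI)
    (simp_all add: graded_homD[OF assms(1)] graded_homD[OF assms(2)])

context graded_module_over
begin

lemmas gcomp_mem = comp_sub

lemma graded_hom_zero: "graded_hom B L M (\<lambda>_. 0)"
  by (rule graded_homI) (simp_all add: act_zero)

lemma graded_hom_diff:
  assumes "graded_hom B L M f" "graded_hom B L M g"
  shows "graded_hom B L M (\<lambda>x. f x - g x)"
  by (rule graded_homI)
    (simp_all add: graded_homD[OF assms(1)] graded_homD[OF assms(2)] diff_mem act_diff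
      add_subgroup_diff[OF comp_subgroup])

lemma graded_hom_plus:
  assumes "graded_hom B L M f" "graded_hom B L M g"
  shows "graded_hom B L M (\<lambda>x. f x + g x)"
  by (rule graded_homI)
    (simp_all add: graded_homD[OF assms(1)] graded_homD[OF assms(2)] add_mem act_add
      add_subgroup_add[OF comp_subgroup])

lemma graded_hom_0: "graded_hom B M N f \<Longrightarrow> f 0 = 0"
  and graded_hom_minus: "graded_hom B M N f \<Longrightarrow> x \<in> mcarrier M \<Longrightarrow> y \<in> mcarrier M \<Longrightarrow>
    f (x - y) = f x - f y"
  and graded_hom_sum: "graded_hom B M N f \<Longrightarrow> (\<And>s. s \<in> S \<Longrightarrow> h s \<in> mcarrier M) \<Longrightarrow>
    f (sum h S) = (\<Sum>s\<in>S. f (h s))"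
  by (simp_all add: additive_on_subgroup[OF mcarrier_subgroup, of f] graded_hom_add)

lemma graded_hom_part:
  assumes N: "graded_module B N" and f: "graded_hom B M N f" and x: "x \<in> mcarrier M"
  shows "f (homogeneous_part (gcomp M) x i) = homogeneous_part (gcomp N) (f x) i"
proof -
  interpret N: graded_module_over B N
    using galg N by unfold_locales
  have "graded_decomp (gcomp N) (f x) (\<lambda>i. f (homogeneous_part (gcomp M) x i))"
  proof (rule graded_decompI[of _ _ "{i. homogeneous_part (gcomp M) x i \<noteq> 0}"])
    have "f x = f (\<Sum>i | homogeneous_part (gcomp M) x i \<noteq> 0. homogeneous_part (gcomp M) x i)"
      by (rule arg_cong[OF part_sum]) (use x in auto)
    also have "\<dots> = (\<Sum>i | homogeneous_part (gcomp M) x i \<noteq> 0. f (homogeneous_part (gcomp M) x i))"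
      using x by (intro graded_hom_sum[OF f]) (auto intro: gcomp_mem part_mem)
    finally show "f x = \<dots>" .
  qed (use x graded_hom_gcomp[OF f] graded_hom_0[OF f] in auto)
  from N.decomp_unique[OF _ this] show ?thesis
    using graded_hom_mem[OF f x] by simp
qed

end

text \<open>
  Transporting the structure along coordinates gives an isomorphic graded module whose elements
  lie in \<open>k\<^sup>\<nat>\<close>, where the lifting property of graded injectives applies.
\<close>

lemma (in graded_module_over) coordinate_replica:
  obtains M' :: "('b, 'k coords) gmod" and e e' where
    "graded_module B M'" "graded_hom B M M' e" "graded_hom B M' M e'"
    "\<And>x. x \<in> mcarrier M \<Longrightarrow> e' (e x) = x" "\<And>y. y \<in> mcarrier M' \<Longrightarrow> e (e' y) = y"
proof -
  obtain e :: "'v \<Rightarrow> 'k coords" and N where inj: "inj_on e (mcarrier M)"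
    and add: "\<And>x y. x \<in> mcarrier M \<Longrightarrow> y \<in> mcarrier M \<Longrightarrow> e (x + y) = e x + e y"
    by (rule coordinates_ex) (rule that)
  define e' where "e' = inv_into (mcarrier M) e"
  have e': "e' (e x) = x" if "x \<in> mcarrier M" for x
    unfolding e'_def using inj that by simp
  define M' :: "('b, 'k coords) gmod" where
    "M' = \<lparr>mcarrier = e ` mcarrier M, act = (\<lambda>b y. e (act M b (e' y))), gcomp = (\<lambda>i. e ` gcomp M i)\<rparr>"
  have sel: "mcarrier M' = e ` mcarrier M" "act M' b y = e (act M b (e' y))"
    "gcomp M' i = e ` gcomp M i" for b y i
    by (simp_all add: M'_def)
  note e_diff = additive_diff[OF mcarrier_subgroup add]
    and e_zero = additive_zero[OF mcarrier_subgroup add]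
    and e_sum = additive_sum[OF mcarrier_subgroup add]
  have sub_image: "add_subgroup (e ` U)" if U: "add_subgroup U" "U \<subseteq> mcarrier M" for U
    unfolding add_subgroup_def
  proof (intro conjI ballI)
    show "0 \<in> e ` U"
      using add_subgroup_zero[OF U(1)] e_zero by (metis imageI)
    fix x y assume "x \<in> e ` U" "y \<in> e ` U"
    then obtain u v where uv: "u \<in> U" "v \<in> U" "x = e u" "y = e v"
      by blast
    then have "x - y = e (u - v)"
      using e_diff U(2) by (simp add: subset_iff)
    then show "x - y \<in> e ` U"
      using add_subgroup_diff[OF U(1) uv(1,2)] by blast
  qed
  have fd: "fd_module B M'"
  proof -
    obtain S where S: "finite S" "S \<subseteq> mcarrier M"
      and span: "\<And>x. x \<in> mcarrier M \<Longrightarrow> \<exists>c. x = combination c S"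
      by (rule basis_ex) (rule that)
    have "\<exists>c. e x = (\<Sum>s\<in>e ` S. act M' (scalar (c s)) s)" if x: "x \<in> mcarrier M" for x
    proof -
      obtain c where "x = combination c S"
        using span[OF x] by blast
      then have "e x = (\<Sum>s\<in>S. e (act M (scalar (c s)) s))"
        unfolding combination_def using S(2) by (simp add: e_sum subset_iff)
      also have "\<dots> = (\<Sum>s\<in>e ` S. act M' (scalar (c (e' s))) s)"
        using S(2) inj
        by (subst sum.reindex) (auto simp: sel e' subset_iff intro!: sum.cong dest: inj_on_subset)
      finally show ?thesis
        by (rule exI[of _ "\<lambda>s. c (e' s)"])
    qed
    then have "\<exists>S. finite S \<and> S \<subseteq> mcarrier M' \<and>
        (\<forall>y\<in>mcarrier M'. \<exists>c. y = (\<Sum>s\<in>S. act M' (scalar (c s)) s))"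
      using S by (intro exI[of _ "e ` S"]) (auto simp: sel(1))
    then show ?thesis
      unfolding fd_module_def using sub_image[OF mcarrier_subgroup]
      by (auto simp: sel e' add[symmetric] add_mem act_add act_add_left act_mult act_one
          mult_closed add_subgroup_add[OF acarrier_subgroup])
  qed
  have "direct_sum_of (mcarrier M') (gcomp M')"
    unfolding direct_sum_of_def sel
  proof (intro conjI allI ballI)
    show "add_subgroup (e ` gcomp M i)" for i
      using sub_image[OF comp_subgroup] gcomp_mem by blast
    show "e ` gcomp M i \<subseteq> e ` mcarrier M" for i
      using gcomp_mem by blast
    fix y assume "y \<in> e ` mcarrier M"
    then obtain x where x: "x \<in> mcarrier M" "y = e x"
      by blast
    define f where "f = homogeneous_part (gcomp M) x"
    have f: "graded_decomp (gcomp M) x f"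
      unfolding f_def by (rule decomp[OF x(1)])
    show "\<exists>!f. graded_decomp (\<lambda>i. e ` gcomp M i) y f"
    proof (rule ex1I)
      show "graded_decomp (\<lambda>i. e ` gcomp M i) y (\<lambda>i. e (f i))"
      proof (rule graded_decompI[of _ _ "{i. f i \<noteq> 0}"])
        have "e x = e (\<Sum>i | f i \<noteq> 0. f i)"
          using f by (simp add: graded_decomp_def)
        also have "\<dots> = (\<Sum>i | f i \<noteq> 0. e (f i))"
          by (rule e_sum) (use gcomp_mem[OF graded_decomp_mem[OF f]] in simp_all)
        finally show "y = (\<Sum>i | f i \<noteq> 0. e (f i))"
          using x(2) by simp
      qed (use graded_decomp_mem[OF f] graded_decomp_finite[OF f] e_zero in auto)
      fix g assume g: "graded_decomp (\<lambda>i. e ` gcomp M i) y g"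
      have "\<forall>i. \<exists>v. v \<in> gcomp M i \<and> g i = e v"
        using graded_decomp_mem[OF g] by blast
      then obtain h where h: "\<And>i. h i \<in> gcomp M i" "\<And>i. g i = e (h i)"
        by metis
      have h_zero: "h i = 0 \<longleftrightarrow> g i = 0" for i
        using e'[OF gcomp_mem[OF h(1)], of i] e'[OF zero_mem] e_zero h(2)[of i] by metis
      have "graded_decomp (gcomp M) x h"
      proof (rule graded_decompI[of _ _ "{i. g i \<noteq> 0}"])
        have "e x = e (\<Sum>i | g i \<noteq> 0. h i)"
          using g x(2) h gcomp_mem by (subst e_sum) (auto simp: graded_decomp_def)
        then show "x = (\<Sum>i | g i \<noteq> 0. h i)"
          using inj x(1) h(1) gcomp_mem by (auto dest!: inj_onD intro!: sum_mem)
      qed (use h(1) h_zero graded_decomp_finite[OF g] in auto)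
      from decomp_unique[OF x(1) this] show "g = (\<lambda>i. e (f i))"
        using h(2) by (auto simp: f_def)
    qed
  qed
  moreover have "\<forall>n i. \<forall>b\<in>agr B n. \<forall>y\<in>gcomp M' i. act M' b y \<in> gcomp M' (int n + i)"
    using act_gcomp by (auto simp: sel e' gcomp_mem)
  ultimately have "graded_module B M'"
    using fd by (simp add: graded_module_def)
  moreover have "graded_hom B M M' e"
    by (rule graded_homI) (auto simp: sel add e')
  moreover have "graded_hom B M' M e'"
    by (rule graded_homI) (auto simp: sel add[symmetric] e' add_mem gcomp_mem)
  moreover have "e (e' y) = y" if "y \<in> mcarrier M'" for y
    using that e' by (auto simp: sel(1))
  ultimately show thesis
    using that[of M' e e'] e' by blast
qed

text \<open>
  The lifting property, freed from the restriction to modules in coordinates: it is applied to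
  replicas of \<open>X\<close> and \<open>Y\<close> and its result is pulled back.
\<close>

lemma graded_injective_extend:
  fixes I :: "('b::ring, 'k::field coords) gmod"
    and X :: "('b, 'x::ab_group_add) gmod" and Y :: "('b, 'y::ab_group_add) gmod"
  assumes B: "graded_algebra B" and I: "graded_injective B I"
    and X: "graded_module B X" and Y: "graded_module B Y"
    and j: "graded_hom B X Y j" "inj_on j (mcarrier X)" and f: "graded_hom B X I f"
  obtains g where "graded_hom B Y I g" "\<And>x. x \<in> mcarrier X \<Longrightarrow> g (j x) = f x"
proof -
  interpret X: graded_module_over B X
    using B X by unfold_locales
  interpret Y: graded_module_over B Y
    using B Y by unfold_locales
  obtain X' :: "('b, 'k coords) gmod" and a a' where
    X': "graded_module B X'" and a: "graded_hom B X X' a" and a': "graded_hom B X' X a'"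
    and a'a: "\<And>x. x \<in> mcarrier X \<Longrightarrow> a' (a x) = x"
    and aa': "\<And>y. y \<in> mcarrier X' \<Longrightarrow> a (a' y) = y"
    by (rule X.coordinate_replica) (rule that)
  obtain Y' :: "('b, 'k coords) gmod" and b b' where
    Y': "graded_module B Y'" and b: "graded_hom B Y Y' b" and b': "graded_hom B Y' Y b'"
    and b'b: "\<And>y. y \<in> mcarrier Y \<Longrightarrow> b' (b y) = y"
    and bb': "\<And>y. y \<in> mcarrier Y' \<Longrightarrow> b (b' y) = y"
    by (rule Y.coordinate_replica) (rule that)
  have j': "graded_hom B X' Y' (\<lambda>x. b (j (a' x)))"
    by (intro graded_hom_comp[OF _ b] graded_hom_comp[OF a' j(1)])
  have "inj_on (\<lambda>x. b (j (a' x))) (mcarrier X')"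
  proof (rule inj_onI)
    fix x y assume xy: "x \<in> mcarrier X'" "y \<in> mcarrier X'" "b (j (a' x)) = b (j (a' y))"
    then have "j (a' x) = j (a' y)"
      by (metis b'b graded_hom_mem[OF a'] graded_hom_mem[OF j(1)])
    then have "a' x = a' y"
      using inj_onD[OF j(2)] graded_hom_mem[OF a'] xy by blast
    then show "x = y"
      by (metis aa' xy(1,2))
  qed
  then obtain g where g: "graded_hom B Y' I g"
    "\<And>x. x \<in> mcarrier X' \<Longrightarrow> g (b (j (a' x))) = f (a' x)"
    using I X' Y' j' graded_hom_comp[OF a' f] unfolding graded_injective_def by blast
  show thesis
  proof (rule that)
    show "graded_hom B Y I (\<lambda>y. g (b y))"
      by (rule graded_hom_comp[OF b g(1)])
    show "g (b (j x)) = f x" if "x \<in> mcarrier X" for x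
      using g(2)[OF graded_hom_mem[OF a that]] a'a[OF that] by simp
  qed
qed

section \<open>Shifts\<close>

lemma shift_sel [simp]:
  "mcarrier (shift r M) = mcarrier M" "act (shift r M) = act M"
  "gcomp (shift r M) = (\<lambda>i. gcomp M (i - r))"
  by (simp_all add: shift_def)

lemma shift_shift [simp]: "shift r (shift s M) = shift (r + s) M"
  by (simp add: shift_def algebra_simps)

lemma shift_0 [simp]: "shift 0 M = M"
  by (simp add: shift_def)

lemma fd_module_cong:
  assumes "mcarrier M = mcarrier N" "act M = act N"
  shows "fd_module A M = fd_module A N"
  by (simp add: fd_module_def assms)

lemma graded_module_shift:
  assumes "graded_module B M"
  shows "graded_module B (shift r M)"
proof -
  have "fd_module B M" and ds: "direct_sum_of (mcarrier M) (gcomp M)"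
    and act: "\<And>n i b x. b \<in> agr B n \<Longrightarrow> x \<in> gcomp M i \<Longrightarrow> act M b x \<in> gcomp M (int n + i)"
    using assms by (simp_all add: graded_module_def)
  then have "fd_module B (shift r M)"
    using fd_module_cong[of "shift r M" M B] by simp
  moreover have "act M b x \<in> gcomp M (int n + i - r)" if "b \<in> agr B n" "x \<in> gcomp M (i - r)" for b x n i
    using act[OF that] by (simp add: algebra_simps)
  ultimately show ?thesis
    using direct_sum_of_shift[OF ds] by (simp add: graded_module_def)
qed

lemma graded_hom_shift [simp]:
  "graded_hom B (shift r M) (shift r N) f = graded_hom B M N f"
proof -
  have "(\<forall>i. f ` gcomp M (i - r) \<subseteq> gcomp N (i - r)) \<longleftrightarrow> (\<forall>i. f ` gcomp M i \<subseteq> gcomp N i)"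
    by (metis add_diff_cancel_right')
  then show ?thesis
    by (simp add: graded_hom_def mod_hom_def)
qed

lemma graded_injective_shift:
  fixes I :: "('b::ring, 'k::field coords) gmod"
  assumes "graded_injective B I"
  shows "graded_injective B (shift r I)"
  unfolding graded_injective_def
proof (intro conjI allI impI)
  show "graded_module B (shift r I)"
    using assms by (intro graded_module_shift) (simp add: graded_injective_def)
  fix X Y :: "('b, 'k coords) gmod" and j f
  assume h: "graded_module B X \<and> graded_module B Y \<and> graded_hom B X Y j \<and> inj_on j (mcarrier X) \<and>
    graded_hom B X (shift r I) f"
  have unshift: "graded_hom B Z (shift r I) g \<longleftrightarrow> graded_hom B (shift (- r) Z) I g"
    for Z :: "('b, 'k coords) gmod" and g
    using graded_hom_shift[of B "- r" Z "shift r I" g] by simp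
  have "graded_module B (shift (- r) X)" "graded_module B (shift (- r) Y)"
    using h graded_module_shift by blast+
  with h assms have "\<exists>g. graded_hom B (shift (- r) Y) I g \<and> (\<forall>x\<in>mcarrier (shift (- r) X). g (j x) = f x)"
    unfolding graded_injective_def unshift by (metis graded_hom_shift shift_sel(1))
  then show "\<exists>g. graded_hom B Y (shift r I) g \<and> (\<forall>x\<in>mcarrier X. g (j x) = f x)"
    by (simp add: unshift)
qed

text \<open>
  Shifting is an automorphism of the category of graded modules, hence carries injective
  resolutions to injective resolutions.
\<close>

lemma ext_nonzero_shiftI:
  assumes "ext_nonzero B n M N"
  shows "ext_nonzero B n (shift r M) (shift r N)"
proof -
  obtain \<epsilon> I d f where res: "injective_resolution B N \<epsilon> I d"
    and f: "ext_cocycle B M I d n f" "\<not> ext_coboundary B M I d n f"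
    using assms by (auto simp: ext_nonzero_def)
  have "injective_resolution B (shift r N) \<epsilon> (\<lambda>n. shift r (I n)) d"
    using res by (simp add: injective_resolution_def graded_injective_shift hom_kernel_def)
  moreover have "ext_cocycle B (shift r M) (\<lambda>n. shift r (I n)) d n f"
    "\<not> ext_coboundary B (shift r M) (\<lambda>n. shift r (I n)) d n f"
    using f by (simp_all add: ext_cocycle_def ext_coboundary_def split: nat.splits)
  ultimately show ?thesis
    unfolding ext_nonzero_def by blast
qed

lemma ext_nonzero_shift:
  "ext_nonzero B n (shift r M) (shift s N) \<longleftrightarrow> ext_nonzero B n M (shift (s - r) N)"
  using ext_nonzero_shiftI[of B n "shift r M" "shift s N" "- r"]
    ext_nonzero_shiftI[of B n M "shift (s - r) N" r]
  by auto

section \<open>Vanishing of Ext in short exact sequences\<close>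

text \<open>
  Vanishing is measured in one fixed resolution \<open>I\<close>. Thereby the long exact sequence of a short
  exact sequence only uses that \<open>hom(-, I n)\<close> is exact, and no two resolutions have to be
  compared.
\<close>

definition ext_vanishes ::
  "('k::field, 'b::ring) gkalg \<Rightarrow> ('b, 'v::ab_group_add) gmod \<Rightarrow> (nat \<Rightarrow> ('b, 'k coords) gmod) \<Rightarrow>
   (nat \<Rightarrow> 'k coords \<Rightarrow> 'k coords) \<Rightarrow> nat \<Rightarrow> bool" where
  "ext_vanishes B M I d n \<longleftrightarrow> (\<forall>f. ext_cocycle B M I d n f \<longrightarrow> ext_coboundary B M I d n f)"

lemma ext_vanishesI:
  "\<not> ext_nonzero B n M N \<Longrightarrow> injective_resolution B N \<epsilon> I d \<Longrightarrow> ext_vanishes B M I d n"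
  unfolding ext_vanishes_def ext_nonzero_def by blast

definition graded_short_exact ::
  "('k::field, 'b::ring) gkalg \<Rightarrow> ('b, 'u::ab_group_add) gmod \<Rightarrow> ('b, 'v::ab_group_add) gmod \<Rightarrow>
   ('b, 'x::ab_group_add) gmod \<Rightarrow> ('u \<Rightarrow> 'v) \<Rightarrow> ('v \<Rightarrow> 'x) \<Rightarrow> bool" where
  "graded_short_exact B U V X j p \<longleftrightarrow>
     graded_module B U \<and> graded_module B V \<and> graded_module B X \<and>
     graded_hom B U V j \<and> inj_on j (mcarrier U) \<and>
     graded_hom B V X p \<and> p ` mcarrier V = mcarrier X \<and> hom_kernel V p = j ` mcarrier U"

locale short_exact_resolution =
  fixes B :: "('k::field, 'b::ring) gkalg"
    and U :: "('b, 'u::ab_group_add) gmod" and V :: "('b, 'v::ab_group_add) gmod"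
    and X :: "('b, 'x::ab_group_add) gmod" and N :: "('b, 'n::ab_group_add) gmod"
    and j p \<epsilon> I d
  assumes alg: "graded_algebra B" and exact: "graded_short_exact B U V X j p"
    and res: "injective_resolution B N \<epsilon> I d"
begin

lemma graded_modules: "graded_module B U" "graded_module B V" "graded_module B X"
  and j: "graded_hom B U V j" "inj_on j (mcarrier U)"
  and p: "graded_hom B V X p" "p ` mcarrier V = mcarrier X"
  and ker_p: "hom_kernel V p = j ` mcarrier U"
  using exact by (simp_all add: graded_short_exact_def)

lemma injective: "graded_injective B (I n)" and differential: "graded_hom B (I n) (I (Suc n)) (d n)"
  using res by (simp_all add: injective_resolution_def)

lemma differential_differential: "x \<in> mcarrier (I n) \<Longrightarrow> d (Suc n) (d n x) = 0"
proof -
  assume "x \<in> mcarrier (I n)"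
  then have "d n x \<in> hom_kernel (I (Suc n)) (d (Suc n))"
    using res unfolding injective_resolution_def by blast
  then show ?thesis
    by (simp add: hom_kernel_def)
qed

end

sublocale short_exact_resolution \<subseteq> V: graded_module_over B V
  by unfold_locales (fact alg graded_modules)+

sublocale short_exact_resolution \<subseteq> X: graded_module_over B X
  by unfold_locales (fact alg graded_modules)+

sublocale short_exact_resolution \<subseteq> I: graded_module_over B "I n" for n
  using injective by unfold_locales (simp_all add: alg graded_injective_def)

context short_exact_resolution
begin

lemma p_j: "u \<in> mcarrier U \<Longrightarrow> p (j u) = 0"
  using ker_p by (auto simp: hom_kernel_def)

lemma extend:
  assumes "graded_hom B U (I n) f"
  obtains g where "graded_hom B V (I n) g" "\<And>u. u \<in> mcarrier U \<Longrightarrow> g (j u) = f u"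
  by (rule graded_injective_extend[OF alg injective graded_modules(1,2) j assms]) (rule that)

text \<open>
  A map that is zero on the image of \<open>U\<close> descends to \<open>V / U \<cong> X\<close>. It respects degrees because
  a homogeneous element of \<open>X\<close> has a homogeneous preimage, namely the corresponding part of any
  preimage.
\<close>

lemma factor:
  assumes f: "graded_hom B V (I n) f" and zero: "\<And>u. u \<in> mcarrier U \<Longrightarrow> f (j u) = 0"
  obtains h where "graded_hom B X (I n) h" "\<And>v. v \<in> mcarrier V \<Longrightarrow> h (p v) = f v"
proof -
  define lift where "lift = inv_into (mcarrier V) p"
  have lift: "lift x \<in> mcarrier V" "p (lift x) = x" if "x \<in> mcarrier X" for x
    using that p(2) unfolding lift_def by (simp_all add: inv_into_into f_inv_into_f)
  have well: "f v = f w" if vw: "v \<in> mcarrier V" "w \<in> mcarrier V" "p v = p w" for v w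
  proof -
    have "v - w \<in> hom_kernel V p"
      using vw V.graded_hom_minus[OF p(1)] by (simp add: hom_kernel_def V.diff_mem)
    then have "f (v - w) = 0"
      using ker_p zero by auto
    then show ?thesis
      using V.graded_hom_minus[OF f] vw by simp
  qed
  have h: "f (lift (p v)) = f v" if "v \<in> mcarrier V" for v
    using lift[OF graded_hom_mem[OF p(1) that]] that by (intro well)
  show thesis
  proof (rule that[of "\<lambda>x. f (lift x)"])
    show "graded_hom B X (I n) (\<lambda>x. f (lift x))"
    proof (rule graded_homI)
      show "f (lift x) \<in> mcarrier (I n)" if "x \<in> mcarrier X" for x
        by (rule graded_hom_mem[OF f lift(1)[OF that]])
      fix x assume x: "x \<in> mcarrier X"
      show "f (lift (x + y)) = f (lift x) + f (lift y)" if y: "y \<in> mcarrier X" for y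
        using h[of "lift x + lift y"] lift[OF x] lift[OF y]
        by (simp add: V.add_mem graded_hom_add[OF p(1)] graded_hom_add[OF f])
      show "f (lift (act X a x)) = act (I n) a (f (lift x))" if a: "a \<in> acarrier B" for a
        using h[of "act V a (lift x)"] lift[OF x] a
        by (simp add: graded_hom_act[OF p(1)] graded_hom_act[OF f])
    next
      fix x i assume x: "x \<in> gcomp X i"
      define v where "v = homogeneous_part (gcomp V) (lift x) i"
      have v: "v \<in> gcomp V i"
        unfolding v_def using lift[OF X.gcomp_mem[OF x]] by simp
      have "p v = x"
        unfolding v_def using x lift[OF X.gcomp_mem[OF x]]
        by (simp add: V.graded_hom_part[OF graded_modules(3) p(1)] X.part_homogeneous)
      then have "f (lift x) = f v"
        using h[OF V.gcomp_mem[OF v]] by simp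
      then show "f (lift x) \<in> gcomp (I n) i"
        using graded_hom_gcomp[OF f v] by simp
    qed
  qed (rule h)
qed

text \<open>
  Exactness of \<open>ext\<^sup>n(X) \<rightarrow> ext\<^sup>n(V) \<rightarrow> ext\<^sup>n(U)\<close> in the middle.
  A cocycle \<open>f\<close> on \<open>V\<close> restricts to a coboundary \<open>d g\<close> on \<open>U\<close>; after extending \<open>g\<close> to
  \<open>V\<close>, the difference \<open>f - d g\<close> comes from a cocycle on \<open>X\<close>.
\<close>

lemma ext_vanishes_extension:
  assumes U: "ext_vanishes B U I d n" and X: "ext_vanishes B X I d n"
  shows "ext_vanishes B V I d n"
  unfolding ext_vanishes_def
proof (intro allI impI)
  fix f assume "ext_cocycle B V I d n f"
  then have f: "graded_hom B V (I n) f" and df: "\<And>v. v \<in> mcarrier V \<Longrightarrow> d n (f v) = 0"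
    by (auto simp: ext_cocycle_def)
  have "ext_cocycle B U I d n (\<lambda>u. f (j u))"
    using df by (simp add: ext_cocycle_def graded_hom_comp[OF j(1) f] graded_hom_mem[OF j(1)])
  then have fj: "ext_coboundary B U I d n (\<lambda>u. f (j u))"
    using U by (simp add: ext_vanishes_def)
  have coboundary_X: "ext_coboundary B X I d n h"
    if h: "graded_hom B X (I n) h" and dh: "\<And>v. v \<in> mcarrier V \<Longrightarrow> d n (h (p v)) = 0" for h
  proof -
    have "ext_cocycle B X I d n h"
      unfolding ext_cocycle_def p(2)[symmetric] using h dh by blast
    then show ?thesis
      using X by (simp add: ext_vanishes_def)
  qed
  show "ext_coboundary B V I d n f"
  proof (cases n)
    case 0
    with fj have zero: "f (j u) = 0" if "u \<in> mcarrier U" for u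
      using that by (simp add: ext_coboundary_def)
    obtain h where h: "graded_hom B X (I n) h" "\<And>v. v \<in> mcarrier V \<Longrightarrow> h (p v) = f v"
      by (rule factor[OF f], erule zero) (rule that)
    then show ?thesis
      using coboundary_X[OF h(1)] df 0 graded_hom_mem[OF p(1)] by (auto simp: ext_coboundary_def)
  next
    case (Suc m)
    with fj obtain g where g: "graded_hom B U (I m) g" "\<And>u. u \<in> mcarrier U \<Longrightarrow> f (j u) = d m (g u)"
      by (auto simp: ext_coboundary_def)
    obtain g' where g': "graded_hom B V (I m) g'" "\<And>u. u \<in> mcarrier U \<Longrightarrow> g' (j u) = g u"
      by (rule extend[OF g(1)]) (rule that)
    have dg': "graded_hom B V (I n) (\<lambda>v. d m (g' v))"
      unfolding Suc by (rule graded_hom_comp[OF g'(1) differential])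
    have hom: "graded_hom B V (I n) (\<lambda>v. f v - d m (g' v))"
      by (rule I.graded_hom_diff[OF f dg'])
    have zero: "f (j u) - d m (g' (j u)) = 0" if "u \<in> mcarrier U" for u
      using g(2) g'(2) that by simp
    obtain h where h: "graded_hom B X (I n) h"
      "\<And>v. v \<in> mcarrier V \<Longrightarrow> h (p v) = f v - d m (g' v)"
      by (rule factor[OF hom], erule zero) (rule that)
    have "d n (h (p v)) = 0" if v: "v \<in> mcarrier V" for v
    proof -
      have "d n (h (p v)) = d n (f v) - d n (d m (g' v))"
        unfolding h(2)[OF v] using graded_hom_mem[OF f v] graded_hom_mem[OF dg' v]
        by (rule I.graded_hom_minus[OF differential])
      then show ?thesis
        using df[OF v] differential_differential[OF graded_hom_mem[OF g'(1) v]] Suc by simp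
    qed
    from coboundary_X[OF h(1) this] Suc
    obtain k where k: "graded_hom B X (I m) k" "\<And>x. x \<in> mcarrier X \<Longrightarrow> h x = d m (k x)"
      by (auto simp: ext_coboundary_def)
    have kp: "graded_hom B V (I m) (\<lambda>v. k (p v))"
      by (rule graded_hom_comp[OF p(1) k(1)])
    have "graded_hom B V (I m) (\<lambda>v. g' v + k (p v))"
      by (rule I.graded_hom_plus[OF g'(1) kp])
    moreover have "f v = d m (g' v + k (p v))" if v: "v \<in> mcarrier V" for v
      using h(2)[OF v] k(2)[OF graded_hom_mem[OF p(1) v]]
        graded_hom_add[OF differential graded_hom_mem[OF g'(1) v] graded_hom_mem[OF kp v]]
      by (simp add: algebra_simps)
    ultimately show ?thesis
      using Suc by (auto simp: ext_coboundary_def)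
  qed
qed

text \<open>
  Exactness of \<open>ext\<^sup>n(V) \<rightarrow> ext\<^sup>n(U) \<rightarrow> ext\<^sup>n\<^sup>+\<^sup>1(X)\<close> in the middle.
  If \<open>f'\<close> extends a cocycle on \<open>U\<close> to \<open>V\<close>, then \<open>d f'\<close> comes from a cocycle on \<open>X\<close>. This is
  the connecting map; once that cocycle is \<open>d k\<close>, subtracting \<open>k\<close> corrects \<open>f'\<close> to a cocycle
  with the same restriction to \<open>U\<close>.
\<close>

lemma ext_vanishes_subobject:
  assumes V: "ext_vanishes B V I d n" and X: "ext_vanishes B X I d (Suc n)"
  shows "ext_vanishes B U I d n"
  unfolding ext_vanishes_def
proof (intro allI impI)
  fix f assume "ext_cocycle B U I d n f"
  then have f: "graded_hom B U (I n) f" and df: "\<And>u. u \<in> mcarrier U \<Longrightarrow> d n (f u) = 0"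
    by (auto simp: ext_cocycle_def)
  obtain f' where f': "graded_hom B V (I n) f'" "\<And>u. u \<in> mcarrier U \<Longrightarrow> f' (j u) = f u"
    by (rule extend[OF f]) (rule that)
  have df': "graded_hom B V (I (Suc n)) (\<lambda>v. d n (f' v))"
    by (rule graded_hom_comp[OF f'(1) differential])
  have zero: "d n (f' (j u)) = 0" if "u \<in> mcarrier U" for u
    using df f'(2) that by simp
  obtain h where h: "graded_hom B X (I (Suc n)) h"
    "\<And>v. v \<in> mcarrier V \<Longrightarrow> h (p v) = d n (f' v)"
    by (rule factor[OF df'], erule zero) (rule that)
  have "d (Suc n) (h (p v)) = 0" if "v \<in> mcarrier V" for v
    using h(2)[OF that] differential_differential[OF graded_hom_mem[OF f'(1) that]] by simp
  then have "d (Suc n) (h x) = 0" if "x \<in> mcarrier X" for x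
    using that unfolding p(2)[symmetric] by blast
  with h(1) X have "ext_coboundary B X I d (Suc n) h"
    by (simp add: ext_vanishes_def ext_cocycle_def)
  then obtain k where k: "graded_hom B X (I n) k" "\<And>x. x \<in> mcarrier X \<Longrightarrow> h x = d n (k x)"
    by (auto simp: ext_coboundary_def)
  have kp: "graded_hom B V (I n) (\<lambda>v. k (p v))"
    by (rule graded_hom_comp[OF p(1) k(1)])
  define g where "g v = f' v - k (p v)" for v
  have g: "graded_hom B V (I n) g"
    unfolding g_def by (rule I.graded_hom_diff[OF f'(1) kp])
  have "d n (g v) = 0" if v: "v \<in> mcarrier V" for v
    unfolding g_def I.graded_hom_minus[OF differential graded_hom_mem[OF f'(1) v]
        graded_hom_mem[OF kp v]]
    using h(2)[OF v] k(2)[OF graded_hom_mem[OF p(1) v]] by simp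
  with g V have bound: "ext_coboundary B V I d n g"
    by (simp add: ext_vanishes_def ext_cocycle_def)
  have gj: "g (j u) = f u" if u: "u \<in> mcarrier U" for u
    using f'(2)[OF u] p_j[OF u] X.graded_hom_0[OF k(1)] by (simp add: g_def)
  show "ext_coboundary B U I d n f"
  proof (cases n)
    case 0
    then show ?thesis
      using bound gj graded_hom_mem[OF j(1)] by (simp add: ext_coboundary_def)
  next
    case (Suc m)
    with bound obtain l where l: "graded_hom B V (I m) l" "\<And>v. v \<in> mcarrier V \<Longrightarrow> g v = d m (l v)"
      by (auto simp: ext_coboundary_def)
    have "graded_hom B U (I m) (\<lambda>u. l (j u))"
      by (rule graded_hom_comp[OF j(1) l(1)])
    moreover have "f u = d m (l (j u))" if "u \<in> mcarrier U" for u
      using gj[OF that] l(2)[OF graded_hom_mem[OF j(1) that]] by simp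
    ultimately show ?thesis
      using Suc by (auto simp: ext_coboundary_def)
  qed
qed

end

lemma ext_vanishes_zero_module:
  assumes B: "graded_algebra B" and M: "graded_module B M" and zero: "mcarrier M = {0}"
    and res: "injective_resolution B N \<epsilon> I d"
  shows "ext_vanishes B M I d n"
  unfolding ext_vanishes_def
proof (intro allI impI)
  fix f assume "ext_cocycle B M I d n f"
  then have f: "graded_hom B M (I n) f"
    by (simp add: ext_cocycle_def)
  interpret M: graded_module_over B M
    using B M by unfold_locales
  have f0: "f 0 = 0"
    by (rule M.graded_hom_0[OF f])
  show "ext_coboundary B M I d n f"
  proof (cases n)
    case (Suc m)
    interpret I: graded_module_over B "I m"
      using B res by unfold_locales (simp_all add: injective_resolution_def graded_injective_def)
    have "graded_hom B (I m) (I (Suc m)) (d m)"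
      using res by (simp add: injective_resolution_def)
    then have "d m 0 = 0"
      by (rule I.graded_hom_0)
    then show ?thesis
      using Suc f0 zero I.graded_hom_zero[of M] by (auto simp: ext_coboundary_def)
  qed (simp add: ext_coboundary_def zero f0)
qed

section \<open>Truncations\<close>

context graded_module_over
begin

lemma mcarrier_truncation:
  "mcarrier (truncation i M) = {x \<in> mcarrier M. \<forall>j<i. homogeneous_part (gcomp M) x j = 0}"
proof -
  have "(\<exists>f. graded_decomp (gcomp M) x f \<and> (\<forall>j<i. f j = 0)) \<longleftrightarrow>
      (\<forall>j<i. homogeneous_part (gcomp M) x j = 0)" if "x \<in> mcarrier M" for x
    using decomp[OF that] decomp_unique[OF that] by metis
  then show ?thesis
    by (auto simp: truncation_def)
qed

lemma truncation_sel [simp]: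
  "act (truncation i M) = act M"
  "gcomp (truncation i M) j = (if i \<le> j then gcomp M j else {0})"
  by (simp_all add: truncation_def)

lemma part_diff:
  assumes "x \<in> mcarrier M" "y \<in> mcarrier M"
  shows "homogeneous_part (gcomp M) (x - y) j =
    homogeneous_part (gcomp M) x j - homogeneous_part (gcomp M) y j"
  using assms by (intro additive_diff[OF mcarrier_subgroup]) (auto simp: part_add add_mem)

lemma part_zero [simp]: "homogeneous_part (gcomp M) 0 j = 0"
  using part_homogeneous[OF comp_zero] by simp

text \<open>
  Algebra elements of positive degree raise degrees. Hence truncations are submodules, and on
  the quotient by the next truncation only the degree-zero part of the algebra acts.
\<close>

lemma part_act_truncation:
  assumes b: "b \<in> acarrier B" and x: "x \<in> mcarrier (truncation i M)"
  shows "j < i \<Longrightarrow> homogeneous_part (gcomp M) (act M b x) j = 0"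
    and "homogeneous_part (gcomp M) (act M b x) i =
      act M (degree_zero_part B b) (homogeneous_part (gcomp M) x i)"
proof -
  define F where "F = {n. homogeneous_part (agr B) b n \<noteq> 0}"
  have F: "finite F"
    unfolding F_def using b by simp
  have xM: "x \<in> mcarrier M" and low: "\<And>j. j < i \<Longrightarrow> homogeneous_part (gcomp M) x j = 0"
    using x by (simp_all add: mcarrier_truncation)
  have b_mem: "homogeneous_part (agr B) b n \<in> acarrier B" for n
    by (rule agr.comp_sub[OF agr.part_mem[OF b]])
  have x_mem: "homogeneous_part (gcomp M) x n \<in> mcarrier M" for n
    by (rule gcomp_mem[OF part_mem[OF xM]])
  note act = part_act[OF b xM, folded F_def]
  show "homogeneous_part (gcomp M) (act M b x) j = 0" if "j < i"
    unfolding act by (rule sum.neutral) (use that low b_mem in \<open>auto simp: act_zero\<close>)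
  have "homogeneous_part (gcomp M) (act M b x) i =
      (\<Sum>n\<in>F. if n = 0 then act M (degree_zero_part B b) (homogeneous_part (gcomp M) x i) else 0)"
    unfolding act
    by (rule sum.cong) (use low b_mem in \<open>auto simp: act_zero degree_zero_part_eq\<close>)
  also have "\<dots> = act M (degree_zero_part B b) (homogeneous_part (gcomp M) x i)"
    using F act_zero_left[OF x_mem] by (auto simp: F_def degree_zero_part_eq)
  finally show "homogeneous_part (gcomp M) (act M b x) i =
      act M (degree_zero_part B b) (homogeneous_part (gcomp M) x i)" .
qed

lemma submodule_truncation: "submodule B M (mcarrier (truncation i M))"
proof -
  have "act M b x \<in> mcarrier (truncation i M)"
    if "b \<in> acarrier B" "x \<in> mcarrier (truncation i M)" for b x
    using that part_act_truncation(1)[OF that] by (simp add: mcarrier_truncation)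
  then show ?thesis
    unfolding submodule_def add_subgroup_def
    by (auto simp: mcarrier_truncation part_diff diff_mem)
qed

lemma graded_module_truncation: "graded_module B (truncation i M)"
proof -
  have "fd_module B (truncation i M)"
    using submodule_fd_module[OF alg fdm submodule_truncation]
      fd_module_cong[of "truncation i M" "M\<lparr>mcarrier := mcarrier (truncation i M)\<rparr>" B]
    by simp
  moreover have "direct_sum_of (mcarrier (truncation i M)) (gcomp (truncation i M))"
  proof (rule direct_sum_of_restrict[OF ds])
    show "gcomp (truncation i M) j \<subseteq> mcarrier (truncation i M)" for j
      by (auto simp: mcarrier_truncation part_homogeneous gcomp_mem)
  qed (auto simp: mcarrier_truncation)
  moreover have "act M b x \<in> gcomp (truncation i M) (int n + j)"
    if "b \<in> agr B n" "x \<in> gcomp (truncation i M) j" for b n x j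
    using that act_gcomp[of b n x j] act_zero[OF agr.comp_sub[OF that(1)]]
    by (auto split: if_splits)
  ultimately show ?thesis
    by (simp add: graded_module_def del: truncation_sel(2))
qed

lemma truncation_eq_self:
  assumes "nonneg_graded M"
  shows "truncation 0 M = M"
proof -
  have neg: "gcomp M j = {0}" if "j < 0" for j
    using assms that by (simp add: nonneg_graded_def)
  have "homogeneous_part (gcomp M) x j = 0" if "x \<in> mcarrier M" "j < 0" for x j
    using part_mem[OF that(1), of j] neg[OF that(2)] by simp
  then have "mcarrier (truncation 0 M) = mcarrier M"
    by (auto simp: mcarrier_truncation)
  moreover have "gcomp (truncation 0 M) = gcomp M"
    by (rule ext) (auto simp: neg)
  ultimately show ?thesis
    by simp
qed

lemma truncation_eventually_zero:
  obtains k where "\<And>i. i \<ge> k \<Longrightarrow> mcarrier (truncation i M) = {0}"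
proof -
  obtain k where k: "\<And>x j. x \<in> mcarrier M \<Longrightarrow> j \<ge> k \<Longrightarrow> homogeneous_part (gcomp M) x j = 0"
    by (rule degrees_bounded_above) (rule that)
  have "x = 0" if "i \<ge> k" "x \<in> mcarrier (truncation i M)" for x i
  proof (rule eq_zeroI)
    show "homogeneous_part (gcomp M) x j = 0" for j
      using that k[of x j] by (cases "j < i") (auto simp: mcarrier_truncation)
  qed (use that in \<open>simp add: mcarrier_truncation\<close>)
  moreover have "0 \<in> mcarrier (truncation i M)" for i
    by (simp add: mcarrier_truncation)
  ultimately show thesis
    by (intro that) blast
qed

end

section \<open>Modules of pure grade\<close>

lemma degree_zero_algebra_sel [simp]:
  "acarrier (degree_zero_algebra B) = agr B 0" "aone (degree_zero_algebra B) = aone B"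
  "ascale (degree_zero_algebra B) = ascale B"
  by (simp_all add: degree_zero_algebra_def)

lemma inflate_sel [simp]:
  "mcarrier (inflate B X) = mcarrier X" "act (inflate B X) b = act X (degree_zero_part B b)"
  "gcomp (inflate B X) i = (if i = 0 then mcarrier X else {0})"
  by (simp_all add: inflate_def)

lemma component_sel [simp]: "mcarrier (component M i) = gcomp M i" "act (component M i) = act M"
  by (simp_all add: component_def)

context graded_alg
begin

lemma agr_mult: "a \<in> agr B m \<Longrightarrow> b \<in> agr B n \<Longrightarrow> a * b \<in> agr B (m + n)"
  using galg by (simp add: graded_algebra_def)

lemma degree_zero_part_mem: "b \<in> acarrier B \<Longrightarrow> degree_zero_part B b \<in> agr B 0"
  by (simp add: degree_zero_part_eq)

lemma degree_zero_part_homogeneous: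
  "b \<in> agr B n \<Longrightarrow> degree_zero_part B b = (if n = 0 then b else 0)"
  by (simp add: degree_zero_part_eq agr.part_homogeneous)

lemma degree_zero_part_add:
  "a \<in> acarrier B \<Longrightarrow> b \<in> acarrier B \<Longrightarrow>
    degree_zero_part B (a + b) = degree_zero_part B a + degree_zero_part B b"
  by (simp add: degree_zero_part_eq agr.part_add add_subgroup_add[OF acarrier_subgroup])

text \<open>
  Among the products \<open>a\<^sub>m b\<^sub>n\<close> only \<open>a\<^sub>0 b\<^sub>0\<close> has degree zero: this is where it matters that the
  grading of \<open>B\<close> is non-negative.
\<close>

lemma degree_zero_part_mult:
  assumes a: "a \<in> acarrier B" and b: "b \<in> acarrier B"
  shows "degree_zero_part B (a * b) = degree_zero_part B a * degree_zero_part B b"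
proof -
  define F where "F = insert 0 ({n. homogeneous_part (agr B) a n \<noteq> 0} \<union> {n. homogeneous_part (agr B) b n \<noteq> 0})"
  define h where "h m n = homogeneous_part (agr B) a m * homogeneous_part (agr B) b n" for m n
  have F: "finite F"
    unfolding F_def using a b by simp
  have h: "h m n \<in> agr B (m + n)" for m n
    unfolding h_def using a b by (intro agr_mult) simp_all
  note sum0 = additive_sum[OF acarrier_subgroup degree_zero_part_add]
  have inner: "(\<Sum>n\<in>F. h m n) \<in> acarrier B" for m
    by (rule add_subgroup_sum[OF acarrier_subgroup]) (rule agr.comp_sub[OF h])
  have "a * b = (\<Sum>m\<in>F. homogeneous_part (agr B) a m) * (\<Sum>n\<in>F. homogeneous_part (agr B) b n)"
    by (intro arg_cong2[of _ _ _ _ "(*)"] agr.part_sum a b F) (auto simp: F_def)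
  also have "\<dots> = (\<Sum>m\<in>F. \<Sum>n\<in>F. h m n)"
    by (simp add: h_def sum_product)
  finally have "degree_zero_part B (a * b) = (\<Sum>m\<in>F. degree_zero_part B (\<Sum>n\<in>F. h m n))"
    using inner by (simp add: sum0)
  also have "\<dots> = (\<Sum>m\<in>F. \<Sum>n\<in>F. if n = 0 then if m = 0 then h 0 0 else 0 else 0)"
    using agr.comp_sub[OF h] degree_zero_part_homogeneous[OF h]
    by (intro sum.cong refl) (auto simp: sum0 intro!: sum.cong)
  also have "\<dots> = h 0 0"
    using F by (simp add: F_def)
  finally show ?thesis
    by (simp add: h_def degree_zero_part_eq)
qed

lemma graded_module_inflate:
  assumes X: "fd_module (degree_zero_algebra B) X"
  shows "graded_module B (inflate B X)"
proof -
  have sub: "add_subgroup (mcarrier X)"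
    using X by (simp add: fd_module_def)
  have add: "act X a (x + y) = act X a x + act X a y"
    if "a \<in> agr B 0" "x \<in> mcarrier X" "y \<in> mcarrier X" for a x y
    using X that by (simp add: fd_module_def)
  have add_left: "act X (a + b) x = act X a x + act X b x"
    if "a \<in> agr B 0" "b \<in> agr B 0" "x \<in> mcarrier X" for a b x
    using X that by (simp add: fd_module_def)
  have mem: "act X a x \<in> mcarrier X" if "a \<in> agr B 0" "x \<in> mcarrier X" for a x
    using X that by (simp add: fd_module_def)
  have "aone B \<in> agr B 0"
    using galg by (simp add: graded_algebra_def)
  from degree_zero_part_homogeneous[OF this] have one: "degree_zero_part B (aone B) = aone B"
    by simp
  have "fd_module B (inflate B X)"
    using X unfolding fd_module_def
    by (simp add: degree_zero_part_mem degree_zero_part_add degree_zero_part_mult one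
        degree_zero_part_homogeneous[OF scalar_degree_zero])
  moreover have "direct_sum_of (mcarrier X) (gcomp (inflate B X))"
    using direct_sum_of_concentrated[OF sub, of 0] by (simp add: inflate_def)
  moreover have "act X (degree_zero_part B b) x \<in> gcomp (inflate B X) (int n + i)"
    if b: "b \<in> agr B n" and x: "x \<in> gcomp (inflate B X) i" for b n x i
  proof -
    have zero: "act X 0 y = 0" if "y \<in> mcarrier X" for y
      using add_left[OF agr.comp_zero agr.comp_zero that] by simp
    have zero': "act X a 0 = 0" if "a \<in> agr B 0" for a
      using additive_zero[OF sub add[OF that]] by simp
    have "degree_zero_part B b \<in> agr B 0"
      by (rule degree_zero_part_mem[OF agr.comp_sub[OF b]])
    then show ?thesis
      using x zero zero' mem add_subgroup_zero[OF sub]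
      by (auto simp: degree_zero_part_homogeneous[OF b] split: if_splits)
  qed
  ultimately show ?thesis
    by (simp add: graded_module_def)
qed

lemma fd_module_component:
  assumes alg0: "fd_algebra (degree_zero_algebra B)" and M: "graded_module B M"
  shows "fd_module (degree_zero_algebra B) (component M i)"
proof -
  interpret M: graded_module_over B M
    using galg M by unfold_locales
  have "fd_module (degree_zero_algebra B) M"
    using M.fdm agr.comp_sub unfolding fd_module_def by simp
  moreover have "submodule (degree_zero_algebra B) M (gcomp M i)"
    using M.comp_subgroup M.gcomp_mem M.act_gcomp[of _ 0] by (auto simp: submodule_def)
  ultimately have "fd_module (degree_zero_algebra B) (M\<lparr>mcarrier := gcomp M i\<rparr>)"
    by (rule submodule_fd_module[OF alg0])
  then show ?thesis
    using fd_module_cong[of "component M i" "M\<lparr>mcarrier := gcomp M i\<rparr>" "degree_zero_algebra B"]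
    by simp
qed

lemma exact_truncation:
  assumes alg0: "fd_algebra (degree_zero_algebra B)" and M: "graded_module B M"
  shows "graded_short_exact B (truncation (i + 1) M) (truncation i M)
    (shift i (inflate B (component M i))) (\<lambda>x. x) (\<lambda>x. homogeneous_part (gcomp M) x i)"
proof -
  interpret M: graded_module_over B M
    using galg M by unfold_locales
  let ?X = "shift i (inflate B (component M i))"
  let ?p = "\<lambda>x. homogeneous_part (gcomp M) x i"
  have "graded_module B ?X"
    by (intro graded_module_shift graded_module_inflate fd_module_component alg0 M)
  moreover have "graded_hom B (truncation (i + 1) M) (truncation i M) (\<lambda>x. x)"
    by (rule graded_homI) (auto simp: M.mcarrier_truncation split: if_splits)
  moreover have "graded_hom B (truncation i M) ?X ?p"
  proof (rule graded_homI)
    show "?p x \<in> mcarrier ?X" if "x \<in> mcarrier (truncation i M)" for x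
      using that by (simp add: M.mcarrier_truncation)
    show "?p (x + y) = ?p x + ?p y"
      if "x \<in> mcarrier (truncation i M)" "y \<in> mcarrier (truncation i M)" for x y
      using that by (simp add: M.mcarrier_truncation M.part_add M.add_mem)
    show "?p (act (truncation i M) a x) = act ?X a (?p x)"
      if "a \<in> acarrier B" "x \<in> mcarrier (truncation i M)" for a x
      using M.part_act_truncation(2)[OF that] by simp
    show "?p x \<in> gcomp ?X j" if "x \<in> gcomp (truncation i M) j" for x j
      using that by (auto simp: M.part_homogeneous split: if_splits)
  qed
  moreover have "?p ` mcarrier (truncation i M) = mcarrier ?X"
  proof
    show "?p ` mcarrier (truncation i M) \<subseteq> mcarrier ?X"
      by (auto simp: M.mcarrier_truncation)
    show "mcarrier ?X \<subseteq> ?p ` mcarrier (truncation i M)"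
    proof
      fix x assume x: "x \<in> mcarrier ?X"
      then have "x \<in> mcarrier (truncation i M)" "?p x = x"
        by (auto simp: M.mcarrier_truncation M.gcomp_mem M.part_homogeneous)
      then show "x \<in> ?p ` mcarrier (truncation i M)"
        by (metis imageI)
    qed
  qed
  moreover have "hom_kernel (truncation i M) ?p = (\<lambda>x. x) ` mcarrier (truncation (i + 1) M)"
    by (auto simp: hom_kernel_def M.mcarrier_truncation order_le_less)
  ultimately show ?thesis
    using M.graded_module_truncation by (simp add: graded_short_exact_def)
qed

text \<open>
  A section of a filtration of \<open>B\<^sub>0\<close>-modules, regarded in pure grade \<open>i\<close>.
\<close>

lemma exact_section:
  assumes alg0: "fd_algebra (degree_zero_algebra B)"
    and Y: "fd_module (degree_zero_algebra B) Y" and X: "fd_module (degree_zero_algebra B) X"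
    and section_iso: "quotient_iso (degree_zero_algebra B) Y V U X"
  obtains p where "graded_short_exact B (shift i (inflate B (Y\<lparr>mcarrier := U\<rparr>)))
    (shift i (inflate B (Y\<lparr>mcarrier := V\<rparr>))) (shift i (inflate B X)) (\<lambda>x. x) p"
proof -
  let ?B0 = "degree_zero_algebra B"
  obtain f where U: "submodule ?B0 Y U" and V: "submodule ?B0 Y V" and UV: "U \<subseteq> V"
    and f: "mod_hom ?B0 (Y\<lparr>mcarrier := V\<rparr>) X f" "f ` V = mcarrier X"
    and ker: "hom_kernel (Y\<lparr>mcarrier := V\<rparr>) f = U"
    using section_iso by (auto simp: quotient_iso_def)
  have graded: "graded_module B (shift i (inflate B (Y\<lparr>mcarrier := U\<rparr>)))"
    "graded_module B (shift i (inflate B (Y\<lparr>mcarrier := V\<rparr>)))"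
    "graded_module B (shift i (inflate B X))"
    by (intro graded_module_shift graded_module_inflate submodule_fd_module[OF alg0 Y] U V X)+
  have f0: "f 0 = 0"
  proof (rule additive_zero)
    show "add_subgroup V"
      using V by (simp add: submodule_def)
    show "f (x + y) = f x + f y" if "x \<in> V" "y \<in> V" for x y
      using f(1) that by (simp add: mod_hom_def)
  qed
  have sub: "graded_hom B (inflate B (Y\<lparr>mcarrier := U\<rparr>)) (inflate B (Y\<lparr>mcarrier := V\<rparr>)) (\<lambda>x. x)"
    by (rule graded_homI) (use UV in \<open>auto split: if_splits\<close>)
  have hom: "graded_hom B (inflate B (Y\<lparr>mcarrier := V\<rparr>)) (inflate B X) f"
    by (rule graded_homI)
      (use f(1) f0 degree_zero_part_mem in \<open>auto simp: mod_hom_def split: if_splits\<close>)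
  have ker': "hom_kernel (shift i (inflate B (Y\<lparr>mcarrier := V\<rparr>))) f = U"
    using ker by (simp add: hom_kernel_def)
  show thesis
    by (rule that[of f])
      (simp add: graded_short_exact_def graded sub hom f(2) ker')
qed

text \<open>
  Ext vanishes on a filtered module as soon as it vanishes on the possible sections, by going
  up the filtration one extension at a time.
\<close>

lemma ext_vanishes_filtered:
  assumes alg0: "fd_algebra (degree_zero_algebra B)"
    and Y: "fd_module (degree_zero_algebra B) Y"
    and filtration: "has_filtration (degree_zero_algebra B) \<X> Y"
    and res: "injective_resolution B N \<epsilon> I d"
    and sections: "\<And>X. X \<in> \<X> \<Longrightarrow> fd_module (degree_zero_algebra B) X \<and>
      ext_vanishes B (shift i (inflate B X)) I d n"
  shows "ext_vanishes B (shift i (inflate B Y)) I d n"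
proof -
  let ?B0 = "degree_zero_algebra B"
  let ?Y = "\<lambda>U. shift i (inflate B (Y\<lparr>mcarrier := U\<rparr>))"
  obtain l F where F: "F 0 = {0}" "F l = mcarrier Y"
    and steps: "\<And>k. k < l \<Longrightarrow> \<exists>X\<in>\<X>. quotient_iso ?B0 Y (F (Suc k)) (F k) X"
    and zero: "submodule ?B0 Y {0}"
    using filtration by (auto simp: has_filtration_def filtration_between_def)
  have "k \<le> l \<Longrightarrow> ext_vanishes B (?Y (F k)) I d n" for k
  proof (induction k)
    case 0
    have "graded_module B (?Y {0})"
      by (intro graded_module_shift graded_module_inflate submodule_fd_module[OF alg0 Y zero])
    then show ?case
      unfolding F by (rule ext_vanishes_zero_module[OF galg _ _ res]) simp
  next
    case (Suc k)
    then obtain X where X: "X \<in> \<X>" "quotient_iso ?B0 Y (F (Suc k)) (F k) X"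
      using steps[of k] by auto
    obtain p where "graded_short_exact B (?Y (F k)) (?Y (F (Suc k))) (shift i (inflate B X)) (\<lambda>x. x) p"
      by (rule exact_section[OF alg0 Y _ X(2)]) (use sections[OF X(1)] that in blast)+
    then interpret short_exact_resolution B "?Y (F k)" "?Y (F (Suc k))" "shift i (inflate B X)"
      N "\<lambda>x. x" p \<epsilon> I d
      using galg res by unfold_locales
    show ?case
      by (rule ext_vanishes_extension) (use Suc sections[OF X(1)] in simp_all)
  qed
  from this[of l] F show ?thesis
    by simp
qed

text \<open>
  Downward induction, starting from a truncation that is zero: \<open>M\<^bsub>\<ge>i\<^esub>\<close> is
  built from the components \<open>M\<^sub>j\<close> with \<open>j \<ge> i\<close> by extensions.
\<close>

lemma ext_vanishes_truncation_above:
  assumes alg0: "fd_algebra (degree_zero_algebra B)" and M: "graded_module B M"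
    and res: "injective_resolution B N \<epsilon> I d"
    and comps: "\<And>j. j \<ge> i \<Longrightarrow> ext_vanishes B (shift j (inflate B (component M j))) I d n"
  shows "ext_vanishes B (truncation i M) I d n"
proof -
  interpret M: graded_module_over B M
    using galg M by unfold_locales
  obtain k where k: "\<And>i. i \<ge> k \<Longrightarrow> mcarrier (truncation i M) = {0}"
    by (rule M.truncation_eventually_zero) (rule that)
  have "j \<ge> i \<Longrightarrow> ext_vanishes B (truncation j M) I d n" if "j \<le> max i k" for j
    using that
  proof (induction j rule: int_le_induct)
    case base
    show ?case
      by (rule ext_vanishes_zero_module[OF galg M.graded_module_truncation k res]) simp
  next
    case (step j)
    interpret short_exact_resolution B "truncation j M" "truncation (j - 1) M"
      "shift (j - 1) (inflate B (component M (j - 1)))" N "\<lambda>x. x"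
      "\<lambda>x. homogeneous_part (gcomp M) x (j - 1)" \<epsilon> I d
      using exact_truncation[OF alg0 M, of "j - 1"] galg res by unfold_locales simp_all
    show ?case
      by (rule ext_vanishes_extension) (use step comps in simp_all)
  qed
  then show ?thesis
    by simp
qed

text \<open>
  Upward induction, starting from \<open>M\<^bsub>\<ge>0\<^esub> = M\<close>: removing the bottom component
  \<open>M\<^sub>j\<close> costs vanishing of its Ext group one degree higher.
\<close>

lemma ext_vanishes_truncation_below:
  assumes alg0: "fd_algebra (degree_zero_algebra B)" and M: "graded_module B M" "nonneg_graded M"
    and res: "injective_resolution B N \<epsilon> I d"
    and vanishes: "ext_vanishes B M I d n"
    and comps: "\<And>j. 0 \<le> j \<Longrightarrow> j < i \<Longrightarrow>
      ext_vanishes B (shift j (inflate B (component M j))) I d (Suc n)"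
    and "0 \<le> i"
  shows "ext_vanishes B (truncation i M) I d n"
  using \<open>0 \<le> i\<close> comps
proof (induction i rule: int_ge_induct)
  case base
  interpret M: graded_module_over B M
    using galg M by unfold_locales
  show ?case
    using vanishes M.truncation_eq_self[OF M(2)] by simp
next
  case (step i)
  interpret short_exact_resolution B "truncation (i + 1) M" "truncation i M"
    "shift i (inflate B (component M i))" N "\<lambda>x. x"
    "\<lambda>x. homogeneous_part (gcomp M) x i" \<epsilon> I d
    using exact_truncation[OF alg0 M(1)] galg res by unfold_locales simp_all
  show ?case
    by (rule ext_vanishes_subobject) (use step in simp_all)
qed

end

section \<open>Truncations of Q-linear modules\<close>

theorem proposition4p1:
  fixes B :: "('k::alg_closed_field, 'b::ring) gkalg"
    and \<Gamma> :: "'w::order set"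
    and \<Delta> :: "'w \<Rightarrow> ('b, 'd::ab_group_add) amod"
    and nabla :: "'w \<Rightarrow> ('b, 'e::ab_group_add) amod"
    and M :: "('b, 'm::ab_group_add) gmod"
  assumes "q_koszul B \<Gamma> \<Delta> nabla"
    and "q_linear B \<Gamma> nabla M"
    and "\<And>i::nat. has_filtration (degree_zero_algebra B) (\<Delta> ` \<Gamma>) (component M (int i))"
  shows "\<forall>i::nat. q_linear B \<Gamma> nabla (shift (- int i) (truncation (int i) M))"
proof
  fix i :: nat
  have galg: "graded_algebra B" and qh: "quasi_hereditary (degree_zero_algebra B) \<Gamma> \<Delta> nabla"
    and koszul: "\<And>n r \<gamma> \<mu>. \<gamma> \<in> \<Gamma> \<Longrightarrow> \<mu> \<in> \<Gamma> \<Longrightarrow>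
      ext_nonzero B n (inflate B (\<Delta> \<gamma>)) (shift r (inflate B (nabla \<mu>))) \<Longrightarrow> int n = r"
    using assms(1) unfolding q_koszul_def by blast+
  have alg0: "fd_algebra (degree_zero_algebra B)"
    using qh[unfolded quasi_hereditary_def] by (rule conjunct1)
  have "\<forall>\<gamma>\<in>\<Gamma>. fd_module (degree_zero_algebra B) (\<Delta> \<gamma>) \<and>
      fd_module (degree_zero_algebra B) (nabla \<gamma>)"
    using qh[unfolded quasi_hereditary_def, THEN conjunct2, THEN conjunct2] by (rule conjunct1)
  then have \<Delta>: "fd_module (degree_zero_algebra B) (\<Delta> \<gamma>)" if "\<gamma> \<in> \<Gamma>" for \<gamma>
    using that by blast
  have M: "graded_module B M" "nonneg_graded M"
    and linear: "\<And>n r \<mu>. \<mu> \<in> \<Gamma> \<Longrightarrow>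
      ext_nonzero B n M (shift r (inflate B (nabla \<mu>))) \<Longrightarrow> int n = r"
    using assms(2) unfolding q_linear_def by blast+
  interpret graded_alg B
    using galg by unfold_locales
  interpret M: graded_module_over B M
    using galg M by unfold_locales
  \<comment> \<open>Both shifts are moved to the second argument, where the grade becomes \<open>r + i\<close>.\<close>
  have ext: "int n = r"
    if \<mu>: "\<mu> \<in> \<Gamma>"
      and ne: "ext_nonzero B n (truncation (int i) M) (shift (r + int i) (inflate B (nabla \<mu>)))"
    for n r \<mu>
  proof (rule ccontr)
    assume neq: "int n \<noteq> r"
    let ?N = "shift (r + int i) (inflate B (nabla \<mu>))"
    obtain \<epsilon> I d where res: "injective_resolution B ?N \<epsilon> I d"
      and nv: "\<not> ext_vanishes B (truncation (int i) M) I d n"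
      using ne unfolding ext_nonzero_def ext_vanishes_def by blast
    \<comment> \<open>The Q-Koszul condition, shifted by \<open>j\<close>: the degree \<open>m\<close> can only be \<open>(r + i) - j\<close>.\<close>
    have comps: "ext_vanishes B (shift j (inflate B (component M j))) I d m"
      if "0 \<le> j" "int m + j \<noteq> r + int i" for j m
    proof (rule ext_vanishes_filtered[OF alg0 fd_module_component[OF alg0 M(1)] _ res])
      show "has_filtration (degree_zero_algebra B) (\<Delta> ` \<Gamma>) (component M j)"
        using assms(3)[of "nat j"] that(1) by simp
      fix X assume "X \<in> \<Delta> ` \<Gamma>"
      then obtain \<gamma> where \<gamma>: "\<gamma> \<in> \<Gamma>" "X = \<Delta> \<gamma>"
        by blast
      have "\<not> ext_nonzero B m (shift j (inflate B (\<Delta> \<gamma>))) ?N"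
        using koszul[OF \<gamma>(1) \<mu>] that(2) by (force simp: ext_nonzero_shift)
      then show "fd_module (degree_zero_algebra B) X \<and> ext_vanishes B (shift j (inflate B X)) I d m"
        using \<Delta> \<gamma> ext_vanishesI[OF _ res] by blast
    qed
    have "ext_vanishes B (truncation (int i) M) I d n"
    proof (cases "int n > r")
      case True
      \<comment> \<open>For \<open>j \<ge> i\<close> the critical degree \<open>(r + i) - j\<close> is at most \<open>r < n\<close>.\<close>
      then show ?thesis
        by (intro ext_vanishes_truncation_above[OF alg0 M(1) res] comps) simp_all
    next
      case False
      \<comment> \<open>Here \<open>n < r \<le> r + i\<close>, so Q-linearity of \<open>M\<close> applies.\<close>
      have "ext_vanishes B M I d n"
        using linear[OF \<mu>] False neq by (intro ext_vanishesI[OF _ res]) force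
      \<comment> \<open>For \<open>j < i\<close> the critical degree \<open>(r + i) - j\<close> exceeds \<open>r\<close>, while \<open>n + 1 \<le> r\<close>.\<close>
      then show ?thesis
        using False neq
        by (intro ext_vanishes_truncation_below[OF alg0 M res] comps) simp_all
    qed
    with nv show False ..
  qed
  show "q_linear B \<Gamma> nabla (shift (- int i) (truncation (int i) M))"
    unfolding q_linear_def
  proof (intro conjI allI ballI impI)
    show "graded_module B (shift (- int i) (truncation (int i) M))"
      by (rule graded_module_shift[OF M.graded_module_truncation])
    show "nonneg_graded (shift (- int i) (truncation (int i) M))"
      by (simp add: nonneg_graded_def)
    show "int n = r" if "\<mu> \<in> \<Gamma>"
      "ext_nonzero B n (shift (- int i) (truncation (int i) M)) (shift r (inflate B (nabla \<mu>)))"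
      for n r \<mu>
      by (rule ext[OF that(1)]) (use that(2) in \<open>simp add: ext_nonzero_shift\<close>)
  qed
qed

end
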